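(* Let $\Sigma$ be a simplicial complex on the finite vertex set $V$ with $n=\#V$. Let $0\le k\le\dim(\Sigma)-1$ and assume that $\dim(\Sigma)\le n-3$. For each $j$ let $\mu_j^H=\min\sigma(\Delta_j^H)$, and let $d_k=\min_{\tau\in\Sigma_k}\#\{\sigma\in\Sigma_{k+1}\mid\tau\prec\sigma\}$. Then \[d_k\,\mu_k^H+(n-k-2-d_k)\,n\ge (n-k-2)\,\mu_{k+1}^H .\]
   Context: A simplicial complex on a finite set $V$ is a family $\Sigma\subseteq\mathcal P(V)$ closed under taking subsets. $\Sigma_k$ is the set of $\sigma\in\Sigma$ with $\#\sigma=k+1$ (so $\Sigma_{-1}=\{\emptyset\}$ for nonempty $\Sigma$), and $\dim(\Sigma)=\max\{k\mid\Sigma_k\ne\emptyset\}$. Write $\tau\prec\sigma$ if $\tau\subseteq\sigma$ and $\#(\sigma\setminus\tau)=1$. $\mathcal K=\mathcal P(V)$ is the complete complex, $\mathcal K_k$ its simplices of cardinality $k+1$. $\ell^2(\Sigma_k)$ is the space of real (or complex) valued functions on $\Sigma_k$ with $\langle\phi,\psi\rangle=\sum_{\tau\in\Sigma_k}\phi(\tau)\overline{\psi(\tau)}$. Coboundary operators are linear maps $\delta_k:\ell^2(\Sigma_k)\to\ell^2(\Sigma_{k+1})$, $k\ge-1$, with $\delta_{k+1}\delta_k=0$ and $\delta_k1_\tau(\sigma)\in\{\pm1,0\}$, nonzero iff $\tau\prec\sigma$. They are chosen as follows: fix coboundary operators $\widehat\delta_k$ for $\mathcal K$ and put $\delta_k=\pi_{k+1}\widehat\delta_k\iota_k$,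 where $\iota_k:\ell^2(\Sigma_k)\to\ell^2(\mathcal K_k)$ is extension by zero and $\pi_k:\ell^2(\mathcal K_k)\to\ell^2(\Sigma_k)$ is restriction. (The usual oriented simplicial coboundary of the augmented cochain complex is an example; the spectra below do not depend on the choice.) Let $\partial_k=\delta_k^*$ be the adjoint and $\Delta_k^H=\partial_k\delta_k+\delta_{k-1}\partial_{k-1}$ on $\ell^2(\Sigma_k)$, $k\ge0$. $\sigma(A)$ denotes the spectrum of an operator $A$. *)

theory Defs
  imports Complex_Main "Jordan_Normal_Form.Conjugate"
begin

definition simplicial_complex :: "'v set \<Rightarrow> 'v set set \<Rightarrow> bool" where
  "simplicial_complex V X \<longleftrightarrow> X \<subseteq> Pow V \<and> (\<forall>\<sigma>\<in>X. \<forall>\<tau>. \<tau> \<subseteq> \<sigma> \<longrightarrow> \<tau> \<in> X)"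

text \<open>Dimensions are integers, so that the empty simplex has dimension -1.\<close>

definition simplices :: "'v set set \<Rightarrow> int \<Rightarrow> 'v set set" where
  "simplices X k = {\<sigma> \<in> X. finite \<sigma> \<and> int (card \<sigma>) = k + 1}"

text \<open>The empty family has no simplex, not even the empty one; its dimension is set to a
  value below that of every other complex.\<close>

definition complex_dim :: "'v set set \<Rightarrow> int" where
  "complex_dim X = (if X = {} then -2 else Max {k. simplices X k \<noteq> {}})"

definition facet_of :: "'v set \<Rightarrow> 'v set \<Rightarrow> bool" where
  "facet_of \<tau> \<sigma> \<longleftrightarrow> \<tau> \<subseteq> \<sigma> \<and> card (\<sigma> - \<tau>) = 1"

text \<open>
  A function on a finite set \<open>S\<close> is represented by its extension by zero to the whole type.
  In this representation \<open>l2 S\<close> is contained in \<open>l2 T\<close> whenever \<open>S \<subseteq> T\<close>; this inclusion is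
  the extension by zero, and \<open>restrict0 S\<close> is the restriction to \<open>S\<close>.

  The scalars are a type of the sort \<open>{conjugatable_ordered_field, real_normed_field}\<close>, which
  has the instances \<open>real\<close> and \<open>complex\<close> (with trivial and with complex conjugation), so that
  both are treated at once.
\<close>

definition l2 :: "'s set \<Rightarrow> ('s \<Rightarrow> 'a::zero) set" where
  "l2 S = {\<phi>. \<forall>x. x \<notin> S \<longrightarrow> \<phi> x = 0}"

definition restrict0 :: "'s set \<Rightarrow> ('s \<Rightarrow> 'a::zero) \<Rightarrow> 's \<Rightarrow> 'a" where
  "restrict0 S \<phi> = (\<lambda>x. if x \<in> S then \<phi> x else 0)"

definition l2_inner ::
  "'s set \<Rightarrow> ('s \<Rightarrow> 'a::{conjugatable_ordered_field, real_normed_field}) \<Rightarrow> ('s \<Rightarrow> 'a) \<Rightarrow> 'a" where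
  "l2_inner S \<phi> \<psi> = (\<Sum>x\<in>S. \<phi> x * conjugate (\<psi> x))"

text \<open>The point mass at \<open>x\<close>.\<close>

definition delta1 :: "'s \<Rightarrow> 's \<Rightarrow> 'a::zero_neq_one" where
  "delta1 x = (\<lambda>y. if y = x then 1 else 0)"

text \<open>Operators are functions on the whole type; only their values on \<open>l2 S\<close> matter.\<close>

definition l2_linear :: "'s set \<Rightarrow> 's set \<Rightarrow> (('s \<Rightarrow> 'a::comm_ring_1) \<Rightarrow> 's \<Rightarrow> 'a) \<Rightarrow> bool" where
  "l2_linear S T A \<longleftrightarrow> (\<forall>\<phi>\<in>l2 S. A \<phi> \<in> l2 T) \<and>
     (\<forall>\<phi>\<in>l2 S. \<forall>\<psi>\<in>l2 S. A (\<lambda>x. \<phi> x + \<psi> x) = (\<lambda>x. A \<phi> x + A \<psi> x)) \<and>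
     (\<forall>c. \<forall>\<phi>\<in>l2 S. A (\<lambda>x. c * \<phi> x) = (\<lambda>x. c * A \<phi> x))"

definition l2_adjoint ::
  "'s set \<Rightarrow> 's set \<Rightarrow> (('s \<Rightarrow> 'a::{conjugatable_ordered_field, real_normed_field}) \<Rightarrow> 's \<Rightarrow> 'a)
     \<Rightarrow> ('s \<Rightarrow> 'a) \<Rightarrow> 's \<Rightarrow> 'a" where
  "l2_adjoint S T A \<psi> =
     (THE \<chi>. \<chi> \<in> l2 S \<and> (\<forall>\<phi>\<in>l2 S. l2_inner T (A \<phi>) \<psi> = l2_inner S \<phi> \<chi>))"

text \<open>On these finite-dimensional spaces an inverse is automatically linear and bounded.\<close>

definition l2_spectrum :: "'s set \<Rightarrow> (('s \<Rightarrow> 'a::comm_ring_1) \<Rightarrow> 's \<Rightarrow> 'a) \<Rightarrow> 'a set" where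
  "l2_spectrum S A = {c. \<not> bij_betw (\<lambda>\<phi> x. A \<phi> x - c * \<phi> x) (l2 S) (l2 S)}"

text \<open>The minimum is used for self-adjoint operators only, whose spectrum is real.\<close>

definition min_spectrum ::
  "'s set \<Rightarrow> (('s \<Rightarrow> 'a::{comm_ring_1, real_algebra_1}) \<Rightarrow> 's \<Rightarrow> 'a) \<Rightarrow> real" where
  "min_spectrum S A = Min {t. of_real t \<in> l2_spectrum S A}"

definition coboundary_operators ::
  "'v set set \<Rightarrow> (int \<Rightarrow> ('v set \<Rightarrow> 'a::comm_ring_1) \<Rightarrow> 'v set \<Rightarrow> 'a) \<Rightarrow> bool" where
  "coboundary_operators X \<delta> \<longleftrightarrow> (\<forall>k\<ge>-1.
     l2_linear (simplices X k) (simplices X (k + 1)) (\<delta> k) \<and>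
     (\<forall>\<phi>\<in>l2 (simplices X k). \<delta> (k + 1) (\<delta> k \<phi>) = (\<lambda>_. 0)) \<and>
     (\<forall>\<tau>\<in>simplices X k. \<forall>\<sigma>\<in>simplices X (k + 1).
        \<delta> k (delta1 \<tau>) \<sigma> \<in> {1, -1, 0} \<and> (\<delta> k (delta1 \<tau>) \<sigma> \<noteq> 0 \<longleftrightarrow> facet_of \<tau> \<sigma>)))"

text \<open>
  The operators below are those of the complex \<open>X\<close>, obtained from coboundary operators \<open>D\<close> of
  the complete complex.
\<close>

definition coboundary ::
  "'v set set \<Rightarrow> (int \<Rightarrow> ('v set \<Rightarrow> 'a::zero) \<Rightarrow> 'v set \<Rightarrow> 'a) \<Rightarrow> int \<Rightarrow> ('v set \<Rightarrow> 'a) \<Rightarrow> 'v set \<Rightarrow> 'a" where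
  "coboundary X D k \<phi> = restrict0 (simplices X (k + 1)) (D k \<phi>)"

definition boundary ::
  "'v set set \<Rightarrow> (int \<Rightarrow> ('v set \<Rightarrow> 'a::{conjugatable_ordered_field, real_normed_field}) \<Rightarrow> 'v set \<Rightarrow> 'a)
     \<Rightarrow> int \<Rightarrow> ('v set \<Rightarrow> 'a) \<Rightarrow> 'v set \<Rightarrow> 'a" where
  "boundary X D k = l2_adjoint (simplices X k) (simplices X (k + 1)) (coboundary X D k)"

definition hodge_laplacian ::
  "'v set set \<Rightarrow> (int \<Rightarrow> ('v set \<Rightarrow> 'a::{conjugatable_ordered_field, real_normed_field}) \<Rightarrow> 'v set \<Rightarrow> 'a)
     \<Rightarrow> int \<Rightarrow> ('v set \<Rightarrow> 'a) \<Rightarrow> 'v set \<Rightarrow> 'a" where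
  "hodge_laplacian X D k \<phi> = (\<lambda>\<sigma>. boundary X D k (coboundary X D k \<phi>) \<sigma>
     + coboundary X D (k - 1) (boundary X D (k - 1) \<phi>) \<sigma>)"

definition mu_H ::
  "'v set set \<Rightarrow> (int \<Rightarrow> ('v set \<Rightarrow> 'a::{conjugatable_ordered_field, real_normed_field}) \<Rightarrow> 'v set \<Rightarrow> 'a)
     \<Rightarrow> int \<Rightarrow> real" where
  "mu_H X D k = min_spectrum (simplices X k) (hodge_laplacian X D k)"

definition min_degree :: "'v set set \<Rightarrow> int \<Rightarrow> nat" where
  "min_degree X k = Min ((\<lambda>\<tau>. card {\<sigma> \<in> simplices X (k + 1). facet_of \<tau> \<sigma>}) ` simplices X k)"

end

theory Submission
  imports Defs "HOL-Library.Function_Algebras" "HOL-Analysis.Convex"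
begin

text \<open>
  Let \<open>P\<close> and \<open>Q\<close> be the restrictions to the faces and to the non-faces of the complex, and \<open>\<delta>\<close> the
  coboundary of the complete complex, where \<open>\<delta>\<^sup>* \<delta> + \<delta> \<delta>\<^sup>* = n\<close>. As \<open>\<delta>\<^sup>*\<close> preserves functions supported on
  faces, the Laplacian of the complex is \<open>n - P \<delta>\<^sup>* Q \<delta> P\<close>, so \<open>n - \<mu>\<^sub>k\<close> is the squared norm of
  \<open>Q \<delta> P\<close> in degree \<open>k\<close>. Take an eigenfunction \<open>\<phi>\<close> for \<open>\<mu>\<^sub>k\<close>, put \<open>\<psi> = Q \<delta> \<phi>\<close>, and multiply \<open>\<psi>\<close> by
  each vertex \<open>u\<close>. From \<open>\<delta>\<^sup>* (u \<psi>) = \<psi> - u \<delta>\<^sup>* \<psi>\<close> one gets \<open>P \<delta>\<^sup>* (u \<psi>) = - (n - \<mu>\<^sub>k) P (u \<phi>)\<close>.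
  The squared norms of \<open>P (u \<phi>)\<close> add up to at least \<open>d\<^sub>k\<close> times that of \<open>\<phi>\<close>, those of \<open>u \<psi>\<close> to exactly
  \<open>n - k - 2\<close> times that of \<open>\<psi>\<close>, whence \<open>d\<^sub>k (n - \<mu>\<^sub>k) \<le> (n - k - 2) (n - \<mu>\<^sub>k\<^sub>+\<^sub>1)\<close>.
\<close>

subsection \<open>Operators on finitely supported functions\<close>

text \<open>The first index of \<open>a\<close> is the source, so
  \<open>\<lambda>x. A (delta1 x)\<close> is directly the matrix of \<open>A\<close>. Cutting off to
  \<open>T\<close> puts every value into \<open>l2 T\<close>, even for arguments not supported on
  \<open>S\<close>.\<close>

definition kernel_op :: "'s set \<Rightarrow> 's set \<Rightarrow> ('s \<Rightarrow> 's \<Rightarrow> 'a::comm_ring_1) \<Rightarrow> ('s \<Rightarrow> 'a) \<Rightarrow> 's \<Rightarrow> 'a" where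
  "kernel_op S T a \<phi> = restrict0 T (\<lambda>y. \<Sum>x\<in>S. a x y * \<phi> x)"

lemma kernel_op_in_l2 [simp]: "kernel_op S T a \<phi> \<in> l2 T"
  by (simp add: kernel_op_def restrict0_def l2_def)

lemma kernel_op_apply [simp]: "y \<in> T \<Longrightarrow> kernel_op S T a \<phi> y = (\<Sum>x\<in>S. a x y * \<phi> x)"
  by (simp add: kernel_op_def restrict0_def)

lemma l2_eqI:
  assumes "\<phi> \<in> l2 S" and "\<psi> \<in> l2 S" and "\<And>x. x \<in> S \<Longrightarrow> \<phi> x = \<psi> x"
  shows "\<phi> = \<psi>"
proof
  show "\<phi> x = \<psi> x" for x
    using assms by (cases "x \<in> S") (auto simp: l2_def)
qed

lemma l2_expansion:
  fixes \<phi> :: "'s \<Rightarrow> 'a::comm_ring_1"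
  assumes "finite S" and "\<phi> \<in> l2 S"
  shows "\<phi> = (\<lambda>y. \<Sum>x\<in>S. \<phi> x * delta1 x y)"
proof (rule l2_eqI[OF assms(2)])
  show "(\<lambda>y. \<Sum>x\<in>S. \<phi> x * delta1 x y) \<in> l2 S"
    by (auto simp: l2_def delta1_def intro!: sum.neutral)
  show "\<phi> y = (\<Sum>x\<in>S. \<phi> x * delta1 x y)" if "y \<in> S" for y
    using that assms(1) by (simp add: delta1_def if_distrib[of "(*) _"] sum.delta cong: if_cong)
qed

lemma l2_linear_add:
  "l2_linear S T A \<Longrightarrow> \<phi> \<in> l2 S \<Longrightarrow> \<psi> \<in> l2 S \<Longrightarrow> A (\<lambda>x. \<phi> x + \<psi> x) = (\<lambda>x. A \<phi> x + A \<psi> x)"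
  by (simp add: l2_linear_def)

lemma l2_linear_scale:
  "l2_linear S T A \<Longrightarrow> \<phi> \<in> l2 S \<Longrightarrow> A (\<lambda>x. c * \<phi> x) = (\<lambda>x. c * A \<phi> x)"
  by (simp add: l2_linear_def)

lemma l2_linear_sum:
  assumes A: "l2_linear S T A" and "finite I" and "\<And>i. i \<in> I \<Longrightarrow> f i \<in> l2 S"
  shows "A (\<lambda>x. \<Sum>i\<in>I. c i * f i x) = (\<lambda>y. \<Sum>i\<in>I. c i * A (f i) y)"
  using assms(2,3)
proof (induction I)
  case empty
  have "(\<lambda>_. 0) \<in> l2 S" by (simp add: l2_def)
  \<comment> \<open>The zero function goes to zero because it is \<open>0\<close> times
    itself.\<close>
  from l2_linear_scale[OF A this, of 0] show ?case by simp
next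
  case (insert i I)
  have *: "(\<lambda>x. c i * f i x) \<in> l2 S" "(\<lambda>x. \<Sum>j\<in>I. c j * f j x) \<in> l2 S"
    using insert.prems by (auto simp: l2_def intro!: sum.neutral)
  have "A (\<lambda>x. \<Sum>j\<in>insert i I. c j * f j x) = A (\<lambda>x. c i * f i x + (\<Sum>j\<in>I. c j * f j x))"
    using insert.hyps by simp
  also have "\<dots> = (\<lambda>y. A (\<lambda>x. c i * f i x) y + A (\<lambda>x. \<Sum>j\<in>I. c j * f j x) y)"
    by (rule l2_linear_add[OF A *])
  also have "A (\<lambda>x. c i * f i x) = (\<lambda>y. c i * A (f i) y)"
    using A insert.prems by (intro l2_linear_scale) auto
  finally show ?case
    using insert by simp
qed

lemma l2_linear_eq_kernel_op:
  assumes "l2_linear S T A" and "finite S" and "\<phi> \<in> l2 S"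
  shows "A \<phi> = kernel_op S T (\<lambda>x. A (delta1 x)) \<phi>"
proof -
  have d: "delta1 x \<in> l2 S" if "x \<in> S" for x
    using that by (auto simp: l2_def delta1_def)
  have "A \<phi> = A (\<lambda>y. \<Sum>x\<in>S. \<phi> x * delta1 x y)"
    using l2_expansion[OF assms(2,3)] by simp
  also have "\<dots> = (\<lambda>y. \<Sum>x\<in>S. \<phi> x * A (delta1 x) y)"
    using assms(1,2) d by (rule l2_linear_sum)
  finally have *: "A \<phi> = (\<lambda>y. \<Sum>x\<in>S. \<phi> x * A (delta1 x) y)" .
  show ?thesis
  proof (rule l2_eqI)
    show "A \<phi> \<in> l2 T" using assms unfolding l2_linear_def by blast
  qed (auto simp: * mult.commute)
qed

text \<open>Conjugation fixes the entries, so the plain transpose solves the adjoint equation.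
  Testing with point masses shows that it is the only solution, as the definite description
  requires.\<close>

lemma l2_adjoint_kernel_op:
  assumes "finite S" and "finite T"
    and A: "\<And>\<phi>. \<phi> \<in> l2 S \<Longrightarrow> A \<phi> = kernel_op S T a \<phi>"
    and a: "\<And>x y. conjugate (a x y) = a x y"
  shows "l2_adjoint S T A \<psi> = kernel_op T S (\<lambda>y x. a x y) \<psi>"
  unfolding l2_adjoint_def
proof (rule the_equality, intro conjI ballI)
  show "l2_inner T (A \<phi>) \<psi> = l2_inner S \<phi> (kernel_op T S (\<lambda>y x. a x y) \<psi>)" if "\<phi> \<in> l2 S" for \<phi>
    using assms(1,2) that
    by (simp add: l2_inner_def A a sum_conjugate conjugate_dist_mul sum_distrib_left
        sum_distrib_right sum.swap[of _ S T] ac_simps)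
  then have *: "l2_inner T (A \<phi>) \<psi> = l2_inner S \<phi> (kernel_op T S (\<lambda>y x. a x y) \<psi>)" if "\<phi> \<in> l2 S" for \<phi>
    using that by blast
  fix \<chi> assume \<chi>: "\<chi> \<in> l2 S \<and> (\<forall>\<phi>\<in>l2 S. l2_inner T (A \<phi>) \<psi> = l2_inner S \<phi> \<chi>)"
  show "\<chi> = kernel_op T S (\<lambda>y x. a x y) \<psi>"
  proof (rule l2_eqI[of _ S])
    fix x assume x: "x \<in> S"
    have "delta1 x \<in> l2 S" using x by (auto simp: l2_def delta1_def)
    with * \<chi> have "l2_inner S (delta1 x) \<chi> = l2_inner S (delta1 x) (kernel_op T S (\<lambda>y x. a x y) \<psi>)"
      by metis
    moreover have "l2_inner S (delta1 x) \<eta> = conjugate (\<eta> x)" for \<eta> :: "_ \<Rightarrow> 'b"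
      using x assms(1) by (simp add: l2_inner_def delta1_def if_distrib[of "\<lambda>t. t * _"] sum.delta cong: if_cong)
    ultimately show "\<chi> x = kernel_op T S (\<lambda>y x. a x y) \<psi> x"
      by simp
  qed (use \<chi> in auto)
qed simp

section \<open>Bijectivity and spectrum of kernel operators\<close>

lemma sum_pointwise: "(\<Sum>i\<in>I. f i :: 'b \<Rightarrow> 'a::comm_monoid_add) x = (\<Sum>i\<in>I. f i x)"
  by (induction I rule: infinite_finite_induct) (auto simp: plus_fun_def zero_fun_def)

text \<open>Dimension count: injectivity makes the \<open>card S\<close> columns independent, and
  they lie in the span of \<open>card S\<close> point masses. A \<open>\<psi>\<close> outside their
  span would be one independent vector too many.\<close>

lemma kernel_op_surj:
  fixes a :: "'s \<Rightarrow> 's \<Rightarrow> 'a::field"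
  assumes S: "finite S" and inj: "\<And>\<phi>. \<phi> \<in> l2 S \<Longrightarrow> kernel_op S S a \<phi> = (\<lambda>_. 0) \<Longrightarrow> \<phi> = (\<lambda>_. 0)"
    and \<psi>: "\<psi> \<in> l2 S"
  obtains \<phi> where "\<phi> \<in> l2 S" and "kernel_op S S a \<phi> = \<psi>"
proof -
  interpret F: vector_space "\<lambda>c (f :: 's \<Rightarrow> 'a) x. c * f x"
    by standard (auto simp: plus_fun_def algebra_simps)
  define col where "col x = (\<lambda>y. if y \<in> S then a x y else 0)" for x
  have comb: "(\<Sum>x\<in>S. (\<lambda>y. \<phi> x * col x y)) = kernel_op S S a \<phi>" for \<phi>
    by (auto simp: fun_eq_iff kernel_op_def restrict0_def col_def sum_pointwise mult.commute
        intro!: sum.cong)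
  have z: "\<phi> x = 0" if "kernel_op S S a \<phi> = (\<lambda>_. 0)" and "x \<in> S" for \<phi> x
  proof -
    have "kernel_op S S a (restrict0 S \<phi>) = kernel_op S S a \<phi>"
      by (auto simp: kernel_op_def restrict0_def)
    with inj[of "restrict0 S \<phi>"] that(1) have "restrict0 S \<phi> = (\<lambda>_. 0)"
      by (auto simp: l2_def restrict0_def)
    with that(2) show ?thesis
      by (auto simp: restrict0_def fun_eq_iff split: if_splits)
  qed
  \<comment> \<open>Two equal columns would be annihilated by the coefficients \<open>1\<close> and
    \<open>-1\<close>. Distinctness ensures that the set of columns has \<open>card S\<close>
    elements.\<close>
  have col_inj: "inj_on col S"
  proof (rule inj_onI, rule ccontr)
    fix x y assume xy: "x \<in> S" "y \<in> S" "col x = col y" "x \<noteq> y"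
    let ?\<phi> = "\<lambda>w. if w = x then 1 else if w = y then - 1 else 0 :: 'a"
    have "(\<Sum>w\<in>S. (\<lambda>v. ?\<phi> w * col w v)) = (\<Sum>w\<in>{x, y}. (\<lambda>v. ?\<phi> w * col w v))"
      using S xy by (intro sum.mono_neutral_right) (auto simp: zero_fun_def)
    also have "\<dots> = (\<lambda>_. 0)" using xy by (auto simp: plus_fun_def)
    finally have "?\<phi> x = 0" using xy(1) unfolding comb by (rule z)
    then show False by simp
  qed
  have indep: "F.independent (col ` S)"
  proof (rule F.independent_if_scalars_zero)
    fix f v assume f: "(\<Sum>v\<in>col ` S. (\<lambda>y. f v * v y)) = 0" and "v \<in> col ` S"
    then obtain x where x: "x \<in> S" "v = col x" by auto
    have "(\<Sum>x\<in>S. (\<lambda>y. (f \<circ> col) x * col x y)) = 0"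
      using f by (simp add: sum.reindex[OF col_inj])
    then have "(f \<circ> col) x = 0"
      using x(1) unfolding comb zero_fun_def by (rule z)
    then show "f v = 0" using x by simp
  qed (use S in auto)
  have l2_span: "\<phi> \<in> F.span (delta1 ` S)" if "\<phi> \<in> l2 S" for \<phi>
  proof -
    have "\<phi> = (\<Sum>x\<in>S. (\<lambda>y. \<phi> x * delta1 x y))"
      by (subst l2_expansion[OF S that]) (simp add: fun_eq_iff sum_pointwise)
    also have "\<dots> \<in> F.span (delta1 ` S)"
      by (intro F.span_sum F.span_scale F.span_base) auto
    finally show ?thesis .
  qed
  have "\<psi> \<in> F.span (col ` S)"
  proof (rule ccontr)
    assume n: "\<psi> \<notin> F.span (col ` S)"
    then have "F.independent (insert \<psi> (col ` S))"
      using indep by (rule F.independent_insertI)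
    moreover have "insert \<psi> (col ` S) \<subseteq> F.span (delta1 ` S)"
      using \<psi> by (auto intro!: l2_span) (auto simp: l2_def col_def)
    ultimately have "card (insert \<psi> (col ` S)) \<le> card (delta1 ` S :: ('s \<Rightarrow> 'a) set)"
      using S F.independent_span_bound by blast
    also have "\<dots> \<le> card S" using S by (rule card_image_le)
    finally show False
      using n S F.span_base[of \<psi> "col ` S"] by (auto simp: card_image[OF col_inj] card_insert_if split: if_splits)
  qed
  then obtain u where u: "\<psi> = (\<Sum>v\<in>col ` S. (\<lambda>y. u v * v y))"
    using S by (auto simp: F.span_finite)
  have "\<psi> = (\<Sum>x\<in>S. (\<lambda>y. (u \<circ> col) x * col x y))"
    unfolding u by (simp add: sum.reindex[OF col_inj])
  then have "\<psi> = kernel_op S S a (u \<circ> col)" by (simp only: comb)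
  \<comment> \<open>The coefficients outside \<open>S\<close> do not enter the combination; cutting
    them off gives a preimage in \<open>l2 S\<close>.\<close>
  also have "\<dots> = kernel_op S S a (restrict0 S (u \<circ> col))"
    by (auto simp: kernel_op_def restrict0_def)
  finally show ?thesis
    by (intro that[of "restrict0 S (u \<circ> col)"]) (auto simp: l2_def restrict0_def)
qed

text \<open>\<open>A - c\<close> is again given by a kernel, and such an operator is bijective as
  soon as it is injective. So failure of bijectivity means an eigenfunction.\<close>

lemma l2_spectrum_kernel_op:
  fixes a :: "'s \<Rightarrow> 's \<Rightarrow> 'a::field"
  assumes S: "finite S" and A: "\<And>\<phi>. \<phi> \<in> l2 S \<Longrightarrow> A \<phi> = kernel_op S S a \<phi>"
  shows "c \<in> l2_spectrum S A \<longleftrightarrow>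
    (\<exists>\<phi>\<in>l2 S. \<phi> \<noteq> (\<lambda>_. 0) \<and> kernel_op S S a \<phi> = (\<lambda>x. c * \<phi> x))"
proof -
  let ?b = "\<lambda>x y. a x y - (if x = y then c else 0)"
  have shift: "(\<lambda>x. A \<phi> x - c * \<phi> x) = kernel_op S S ?b \<phi>" if "\<phi> \<in> l2 S" for \<phi>
  proof (rule l2_eqI[of _ S])
    show "A \<phi> y - c * \<phi> y = kernel_op S S ?b \<phi> y" if "y \<in> S" for y
      using S that \<open>\<phi> \<in> l2 S\<close>
      by (simp add: A left_diff_distrib sum_subtractf if_distrib[of "\<lambda>t. t * _"] sum.delta cong: if_cong)
  qed (use that in \<open>auto simp: A l2_def kernel_op_def restrict0_def\<close>)
  have diff: "kernel_op S S ?b (\<lambda>x. \<phi> x - \<phi>' x) = (\<lambda>x. kernel_op S S ?b \<phi> x - kernel_op S S ?b \<phi>' x)"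
    for \<phi> \<phi>'
    by (auto simp: kernel_op_def restrict0_def right_diff_distrib sum_subtractf)
  have zero: "kernel_op S S ?b \<phi> = (\<lambda>_. 0) \<longleftrightarrow> kernel_op S S a \<phi> = (\<lambda>x. c * \<phi> x)" if "\<phi> \<in> l2 S" for \<phi>
    using shift[OF that] A[OF that] by (auto simp: fun_eq_iff)
  have "bij_betw (kernel_op S S ?b) (l2 S) (l2 S) \<longleftrightarrow>
      (\<forall>\<phi>\<in>l2 S. kernel_op S S ?b \<phi> = (\<lambda>_. 0) \<longrightarrow> \<phi> = (\<lambda>_. 0))" (is "?B \<longleftrightarrow> ?I")
  proof
    assume ?B
    show ?I
    proof (intro ballI impI)
      fix \<phi> assume \<phi>: "\<phi> \<in> l2 S" "kernel_op S S ?b \<phi> = (\<lambda>_. 0)"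
      have 0: "(\<lambda>_. 0) \<in> l2 S" "kernel_op S S ?b (\<lambda>_. 0) = (\<lambda>_. 0)"
        by (simp_all add: l2_def kernel_op_def restrict0_def fun_eq_iff)
      have "inj_on (kernel_op S S ?b) (l2 S)" using \<open>?B\<close> by (rule bij_betw_imp_inj_on)
      then show "\<phi> = (\<lambda>_. 0)" by (rule inj_onD) (use \<phi> 0 in simp_all)
    qed
  next
    assume I: ?I
    have "inj_on (kernel_op S S ?b) (l2 S)"
    proof (rule inj_onI)
      fix \<phi> \<phi>' assume *: "\<phi> \<in> l2 S" "\<phi>' \<in> l2 S" "kernel_op S S ?b \<phi> = kernel_op S S ?b \<phi>'"
      then have "(\<lambda>x. \<phi> x - \<phi>' x) \<in> l2 S" "kernel_op S S ?b (\<lambda>x. \<phi> x - \<phi>' x) = (\<lambda>_. 0)"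
        by (auto simp: diff l2_def)
      with I have "(\<lambda>x. \<phi> x - \<phi>' x) = (\<lambda>_. 0)" by blast
      then show "\<phi> = \<phi>'" by (auto simp: fun_eq_iff)
    qed
    moreover have "\<psi> \<in> kernel_op S S ?b ` l2 S" if \<psi>: "\<psi> \<in> l2 S" for \<psi>
      by (rule kernel_op_surj[OF S _ \<psi>, of ?b]) (use I in auto)
    ultimately show ?B by (auto simp: bij_betw_def)
  qed
  moreover have "bij_betw (\<lambda>\<phi> x. A \<phi> x - c * \<phi> x) (l2 S) (l2 S)
      \<longleftrightarrow> bij_betw (kernel_op S S ?b) (l2 S) (l2 S)"
    by (intro bij_betw_cong shift)
  ultimately show ?thesis
    using zero by (auto simp: l2_spectrum_def)
qed

lemma real_functional_exists:
  fixes z :: "'a::real_vector"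
  assumes "z \<noteq> 0"
  obtains g :: "'a \<Rightarrow> real" where "linear g" and "g z = 1"
proof -
  have "independent {z}" using assms by simp
  from linear_independent_extend[OF this, of "\<lambda>_. 1"] that show ?thesis by auto
qed

text \<open>This passes from generic scalars to the reals. As the kernel and \<open>t\<close> are
  real, a real-linear functional \<open>g\<close> on the scalars maps eigenfunctions to real
  solutions of the same equation; \<open>g = 1\<close> at a nonzero value \<open>\<phi> x\<close>
  keeps the image nonzero. Conversely, \<open>of_real\<close> embeds real eigenfunctions.\<close>

lemma of_real_in_l2_spectrum_kernel_op:
  fixes a :: "'s \<Rightarrow> 's \<Rightarrow> real"
    and A :: "('s \<Rightarrow> 'a::{field, real_algebra_1}) \<Rightarrow> 's \<Rightarrow> 'a"
  assumes S: "finite S" and A: "\<And>\<phi>. \<phi> \<in> l2 S \<Longrightarrow> A \<phi> = kernel_op S S (\<lambda>x y. of_real (a x y)) \<phi>"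
  shows "of_real t \<in> l2_spectrum S A \<longleftrightarrow>
    (\<exists>\<phi>\<in>l2 S. \<phi> \<noteq> (\<lambda>_. 0) \<and> kernel_op S S a \<phi> = (\<lambda>x. t * \<phi> x))"
proof -
  let ?a = "\<lambda>x y. of_real (a x y) :: 'a"
  have "(\<exists>\<phi>\<in>l2 S. \<phi> \<noteq> (\<lambda>_. 0) \<and> kernel_op S S ?a \<phi> = (\<lambda>x. of_real t * \<phi> x))
    \<longleftrightarrow> (\<exists>\<phi>\<in>l2 S. \<phi> \<noteq> (\<lambda>_. 0) \<and> kernel_op S S a \<phi> = (\<lambda>x. t * \<phi> x))" (is "?L \<longleftrightarrow> ?R")
  proof
    assume ?L
    then obtain \<phi> where \<phi>: "\<phi> \<in> l2 S" "\<phi> \<noteq> (\<lambda>_. 0)" "kernel_op S S ?a \<phi> = (\<lambda>x. of_real t * \<phi> x)"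
      by blast
    then obtain x where "\<phi> x \<noteq> 0" by auto
    then obtain g :: "'a \<Rightarrow> real" where g: "linear g" "g (\<phi> x) = 1"
      by (rule real_functional_exists)
    have sc: "g (of_real r * w) = r * g w" for r w
      using linear_scale[OF g(1), of r w] by (simp add: scaleR_conv_of_real)
    have "kernel_op S S a (g \<circ> \<phi>) y = t * g (\<phi> y)" for y
    proof -
      have "kernel_op S S a (g \<circ> \<phi>) y = g (kernel_op S S ?a \<phi> y)"
        by (simp add: kernel_op_def restrict0_def linear_sum[OF g(1)] sc linear_0[OF g(1)])
      then show ?thesis by (simp add: \<phi> sc)
    qed
    moreover have "g \<circ> \<phi> \<in> l2 S" using \<phi>(1) by (auto simp: l2_def linear_0[OF g(1)])
    moreover have "g \<circ> \<phi> \<noteq> (\<lambda>_. 0)" using g(2) by (auto simp: fun_eq_iff intro!: exI[of _ x])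
    ultimately show ?R by (intro bexI[of _ "g \<circ> \<phi>"]) auto
  next
    assume ?R
    then obtain \<phi> where \<phi>: "\<phi> \<in> l2 S" "\<phi> \<noteq> (\<lambda>_. 0)" "kernel_op S S a \<phi> = (\<lambda>x. t * \<phi> x)"
      by blast
    have "kernel_op S S ?a (\<lambda>x. of_real (\<phi> x)) = (\<lambda>y. of_real (kernel_op S S a \<phi> y))"
      by (auto simp: kernel_op_def restrict0_def)
    with \<phi> show ?L
      by (intro bexI[of _ "\<lambda>x. of_real (\<phi> x)"]) (auto simp: l2_def fun_eq_iff)
  qed
  then show ?thesis by (simp add: l2_spectrum_kernel_op[OF S A])
qed

subsection \<open>The least eigenvalue of a symmetric kernel\<close>

lemma kernel_op_symmetric:
  fixes a :: "'s \<Rightarrow> 's \<Rightarrow> 'a::comm_ring_1"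
  assumes "\<And>x y. a x y = a y x"
  shows "(\<Sum>x\<in>S. \<phi> x * kernel_op S S a \<psi> x) = (\<Sum>x\<in>S. kernel_op S S a \<phi> x * \<psi> x)"
proof -
  have "(\<Sum>x\<in>S. \<phi> x * kernel_op S S a \<psi> x) = (\<Sum>x\<in>S. \<Sum>y\<in>S. \<phi> x * (a y x * \<psi> y))"
    by (simp add: sum_distrib_left)
  also have "\<dots> = (\<Sum>y\<in>S. \<Sum>x\<in>S. \<phi> x * (a y x * \<psi> y))"
    by (rule sum.swap)
  also have "\<dots> = (\<Sum>y\<in>S. kernel_op S S a \<phi> y * \<psi> y)"
    using assms by (intro sum.cong refl) (simp add: sum_distrib_left sum_distrib_right ac_simps)
  finally show ?thesis .
qed

text \<open>Bessel's inequality for the point masses, summed over all points.\<close>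

lemma card_orthonormal_le:
  fixes f :: "'t \<Rightarrow> 's \<Rightarrow> real"
  assumes S: "finite S" and T: "finite T"
    and f: "\<And>t u. t \<in> T \<Longrightarrow> u \<in> T \<Longrightarrow> (\<Sum>x\<in>S. f t x * f u x) = (if t = u then 1 else 0)"
  shows "card T \<le> card S"
proof -
  have le: "(\<Sum>t\<in>T. (f t x)\<^sup>2) \<le> 1" if x: "x \<in> S" for x
  proof -
    \<comment> \<open>The orthogonal projection of the point mass at \<open>x\<close> to the span of
      the family; its squared norm and its pairing with the point mass coincide.\<close>
    let ?g = "\<lambda>y. \<Sum>t\<in>T. f t x * f t y"
    have 1: "(\<Sum>y\<in>S. (if y = x then 1 else 0) * ?g y) = (\<Sum>t\<in>T. (f t x)\<^sup>2)"
      using S x by (simp add: if_distrib[of "\<lambda>t. t * _"] sum.delta power2_eq_square cong: if_cong)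
    have "(\<Sum>y\<in>S. ?g y * ?g y) = (\<Sum>y\<in>S. \<Sum>t\<in>T. \<Sum>u\<in>T. f t x * f u x * (f t y * f u y))"
      by (simp add: sum_product ac_simps)
    also have "\<dots> = (\<Sum>t\<in>T. \<Sum>u\<in>T. \<Sum>y\<in>S. f t x * f u x * (f t y * f u y))"
      by (subst sum.swap, intro sum.cong refl, rule sum.swap)
    also have "\<dots> = (\<Sum>t\<in>T. \<Sum>u\<in>T. f t x * f u x * (if t = u then 1 else 0))"
      by (intro sum.cong refl) (simp add: sum_distrib_left[symmetric] f)
    also have "\<dots> = (\<Sum>t\<in>T. (f t x)\<^sup>2)"
      using T by (simp add: if_distrib[of "(*) _"] sum.delta power2_eq_square cong: if_cong)
    finally have 2: "(\<Sum>y\<in>S. ?g y * ?g y) = (\<Sum>t\<in>T. (f t x)\<^sup>2)" .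
    have 3: "(\<Sum>y\<in>S. (if y = x then 1 else 0) * (if y = x then 1 else 0)) = (1::real)"
      using S x by (simp add: if_distrib[of "\<lambda>t. t * _"] sum.delta cong: if_cong)
    have "0 \<le> (\<Sum>y\<in>S. ((if y = x then 1 else 0) - ?g y)\<^sup>2)"
      by (intro sum_nonneg) auto
    also have "\<dots> = (\<Sum>y\<in>S. (if y = x then 1 else 0) * (if y = x then 1 else 0)
        - 2 * ((if y = x then 1 else 0) * ?g y) + ?g y * ?g y)"
      by (intro sum.cong refl) (simp add: power2_eq_square algebra_simps)
    also have "\<dots> = 1 - 2 * (\<Sum>t\<in>T. (f t x)\<^sup>2) + (\<Sum>t\<in>T. (f t x)\<^sup>2)"
      by (simp only: sum.distrib sum_subtractf sum_distrib_left[symmetric] 1 2 3)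
    finally show ?thesis by simp
  qed
  have "real (card T) = (\<Sum>t\<in>T. \<Sum>x\<in>S. (f t x)\<^sup>2)"
    by (simp add: power2_eq_square f)
  also have "\<dots> = (\<Sum>x\<in>S. \<Sum>t\<in>T. (f t x)\<^sup>2)" by (rule sum.swap)
  also have "\<dots> \<le> (\<Sum>x\<in>S. 1)" by (intro sum_mono le)
  finally show ?thesis by simp
qed

lemma l2_sum_squares_pos:
  fixes \<phi> :: "'s \<Rightarrow> real"
  assumes "finite S" and "\<phi> \<in> l2 S" and "\<phi> \<noteq> (\<lambda>_. 0)"
  shows "0 < (\<Sum>x\<in>S. (\<phi> x)\<^sup>2)"
proof -
  obtain x where "\<phi> x \<noteq> 0" using assms(3) by auto
  then show ?thesis
    using assms(1,2) by (intro sum_pos2[of _ x]) (auto simp: l2_def)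
qed

lemma kernel_op_scale:
  fixes a :: "'s \<Rightarrow> 's \<Rightarrow> 'a::comm_ring_1"
  shows "kernel_op S T a (\<lambda>x. c * \<phi> x) = (\<lambda>x. c * kernel_op S T a \<phi> x)"
  by (auto simp: kernel_op_def restrict0_def sum_distrib_left ac_simps)

lemma l2_normalize:
  fixes \<phi> :: "'s \<Rightarrow> real"
  assumes "finite S" and "\<phi> \<in> l2 S" and "\<phi> \<noteq> (\<lambda>_. 0)"
  obtains c where "c \<noteq> 0" and "(\<lambda>x. c * \<phi> x) \<in> l2 S" and "(\<Sum>x\<in>S. (c * \<phi> x)\<^sup>2) = 1"
proof
  let ?N = "\<Sum>x\<in>S. (\<phi> x)\<^sup>2"
  have N: "0 < ?N" using assms by (rule l2_sum_squares_pos)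
  show "1 / sqrt ?N \<noteq> 0" using N by simp
  show "(\<lambda>x. 1 / sqrt ?N * \<phi> x) \<in> l2 S" using assms(2) by (auto simp: l2_def)
  show "(\<Sum>x\<in>S. (1 / sqrt ?N * \<phi> x)\<^sup>2) = 1"
    using N by (simp add: power_mult_distrib power_divide sum_divide_distrib[symmetric])
qed

text \<open>Symmetry makes eigenfunctions of distinct eigenvalues orthogonal, so there are at most
  \<open>card S\<close> eigenvalues. Finiteness lets \<open>Min\<close> in
  \<open>min_spectrum\<close> denote a true minimum.\<close>

lemma finite_symmetric_eigenvalues:
  fixes a :: "'s \<Rightarrow> 's \<Rightarrow> real"
  assumes S: "finite S" and sym: "\<And>x y. a x y = a y x"
  shows "finite {t. \<exists>\<phi>\<in>l2 S. \<phi> \<noteq> (\<lambda>_. 0) \<and> kernel_op S S a \<phi> = (\<lambda>x. t * \<phi> x)}" (is "finite ?E")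
proof (rule ccontr)
  assume "infinite ?E"
  then obtain T where T: "T \<subseteq> ?E" "finite T" "card T = Suc (card S)"
    using infinite_arbitrarily_large by blast
  have "\<exists>\<phi>\<in>l2 S. (\<Sum>x\<in>S. (\<phi> x)\<^sup>2) = 1 \<and> kernel_op S S a \<phi> = (\<lambda>x. t * \<phi> x)" if t: "t \<in> T" for t
  proof -
    obtain \<phi> where \<phi>: "\<phi> \<in> l2 S" "\<phi> \<noteq> (\<lambda>_. 0)" "kernel_op S S a \<phi> = (\<lambda>x. t * \<phi> x)"
      using subsetD[OF T(1) t] by blast
    from l2_normalize[OF S \<phi>(1,2)] obtain c where
      "c \<noteq> 0" "(\<lambda>x. c * \<phi> x) \<in> l2 S" "(\<Sum>x\<in>S. (c * \<phi> x)\<^sup>2) = 1" .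
    with \<phi>(3) show ?thesis
      by (intro bexI[of _ "\<lambda>x. c * \<phi> x"]) (auto simp: kernel_op_scale)
  qed
  then obtain f where f: "\<And>t. t \<in> T \<Longrightarrow> (\<Sum>x\<in>S. (f t x)\<^sup>2) = 1"
    "\<And>t. t \<in> T \<Longrightarrow> kernel_op S S a (f t) = (\<lambda>x. t * f t x)"
    by metis
  have "(\<Sum>x\<in>S. f t x * f u x) = (if t = u then 1 else 0)" if "t \<in> T" "u \<in> T" for t u
  proof (cases "t = u")
    case True
    then show ?thesis using f(1)[OF that(1)] by (simp add: power2_eq_square)
  next
    case False
    have "(\<Sum>x\<in>S. f t x * (u * f u x)) = (\<Sum>x\<in>S. t * f t x * f u x)"
      using kernel_op_symmetric[where S=S and a=a and \<phi>="f t" and \<psi>="f u", OF sym] f(2) that by simp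
    then have "u * (\<Sum>x\<in>S. f t x * f u x) = t * (\<Sum>x\<in>S. f t x * f u x)"
      by (simp add: sum_distrib_left ac_simps)
    with False show ?thesis by simp
  qed
  from card_orthonormal_le[OF S T(2) this] T(3) show False by simp
qed

section \<open>Attainment of the minimal Rayleigh quotient\<close>

lemma quadratic_nonneg_discriminant:
  fixes p r s :: real
  assumes nonneg: "\<And>t. 0 \<le> p + 2 * t * r + t\<^sup>2 * s" and s: "0 \<le> s"
  shows "r\<^sup>2 \<le> p * s"
proof (cases "s = 0")
  case True
  have "r = 0"
  proof (rule ccontr)
    assume "r \<noteq> 0"
    \<comment> \<open>At this \<open>t\<close> the affine function \<open>p + 2 * t * r\<close>
      equals \<open>-1\<close>.\<close>
    then show False using nonneg[of "- (p + 1) / (2 * r)"] True by (simp add: field_simps)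
  qed
  then show ?thesis using True by simp
next
  case False
  with s have s: "0 < s" by simp
  \<comment> \<open>The quadratic is taken at its minimum point \<open>t = - r / s\<close> and
    cleared of the denominator.\<close>
  have "0 \<le> s * (p + 2 * (- r / s) * r + (- r / s)\<^sup>2 * s)"
    by (intro mult_nonneg_nonneg nonneg) (use s in simp)
  also have "\<dots> = p * s - r\<^sup>2"
    using s by (simp add: field_simps power2_eq_square)
  finally show ?thesis by simp
qed

text \<open>Eigenvectors for the infimum of the Rayleigh quotient exist without any compactness argument:
  a positive semidefinite kernel without null vectors has preimages of the point masses, and the
  Cauchy-Schwarz inequality applied to these bounds its form away from zero.\<close>

lemma psd_kernel_coercive:
  fixes b :: "'s \<Rightarrow> 's \<Rightarrow> real"
  assumes S: "finite S" "S \<noteq> {}" and sym: "\<And>x y. b x y = b y x"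
    and psd: "\<And>\<phi>. \<phi> \<in> l2 S \<Longrightarrow> 0 \<le> (\<Sum>x\<in>S. \<phi> x * kernel_op S S b \<phi> x)"
    and inj: "\<And>\<phi>. \<phi> \<in> l2 S \<Longrightarrow> kernel_op S S b \<phi> = (\<lambda>_. 0) \<Longrightarrow> \<phi> = (\<lambda>_. 0)"
  obtains C where "0 < C"
    and "\<forall>\<phi>\<in>l2 S. (\<Sum>x\<in>S. (\<phi> x)\<^sup>2) \<le> C * (\<Sum>x\<in>S. \<phi> x * kernel_op S S b \<phi> x)"
proof -
  let ?q = "\<lambda>\<phi> \<psi>. \<Sum>x\<in>S. \<phi> x * kernel_op S S b \<psi> x"
  \<comment> \<open>Cauchy-Schwarz for a semidefinite form, from the discriminant of the form along
    \<open>\<phi> + t \<psi>\<close>.\<close>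
  have CS: "(?q \<phi> \<psi>)\<^sup>2 \<le> ?q \<phi> \<phi> * ?q \<psi> \<psi>" if "\<phi> \<in> l2 S" "\<psi> \<in> l2 S" for \<phi> \<psi>
  proof (rule quadratic_nonneg_discriminant)
    fix t
    have "(\<lambda>x. \<phi> x + t * \<psi> x) \<in> l2 S" using that by (auto simp: l2_def)
    then have "0 \<le> ?q (\<lambda>x. \<phi> x + t * \<psi> x) (\<lambda>x. \<phi> x + t * \<psi> x)" by (rule psd)
    also have "kernel_op S S b (\<lambda>x. \<phi> x + t * \<psi> x) = (\<lambda>x. kernel_op S S b \<phi> x + t * kernel_op S S b \<psi> x)"
      by (auto simp: kernel_op_def restrict0_def algebra_simps sum.distrib sum_distrib_left)
    also have "(\<Sum>x\<in>S. (\<phi> x + t * \<psi> x) * (kernel_op S S b \<phi> x + t * kernel_op S S b \<psi> x))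
        = ?q \<phi> \<phi> + t * ?q \<phi> \<psi> + t * ?q \<psi> \<phi> + t\<^sup>2 * ?q \<psi> \<psi>"
      by (simp only: sum_distrib_left sum.distrib[symmetric])
        (intro sum.cong refl, simp add: algebra_simps power2_eq_square)
    also have "?q \<psi> \<phi> = ?q \<phi> \<psi>"
      using kernel_op_symmetric[of b \<psi> S \<phi>, OF sym] by (simp add: mult.commute)
    finally show "0 \<le> ?q \<phi> \<phi> + 2 * t * ?q \<phi> \<psi> + t\<^sup>2 * ?q \<psi> \<psi>" by simp
  qed (use psd that in auto)
  have "\<exists>\<psi>\<in>l2 S. kernel_op S S b \<psi> = delta1 y" if "y \<in> S" for y
  proof -
    have "delta1 y \<in> l2 S" using that by (auto simp: l2_def delta1_def)
    from kernel_op_surj[where a=b, OF S(1) inj this] show ?thesis by blast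
  qed
  then obtain \<psi> where \<psi>: "\<And>y. y \<in> S \<Longrightarrow> \<psi> y \<in> l2 S" "\<And>y. y \<in> S \<Longrightarrow> kernel_op S S b (\<psi> y) = delta1 y"
    by metis
  \<comment> \<open>With respect to the form, \<open>\<psi> y\<close> represents evaluation at
    \<open>y\<close>.\<close>
  have point: "?q \<phi> (\<psi> y) = \<phi> y" if "y \<in> S" for y \<phi>
    using S that by (simp add: \<psi> delta1_def if_distrib[of "(*) _"] sum.delta cong: if_cong)
  define C where "C = (\<Sum>y\<in>S. ?q (\<psi> y) (\<psi> y))"
  have C0: "0 \<le> C" unfolding C_def by (intro sum_nonneg psd \<psi>(1))
  \<comment> \<open>The constant is \<open>C + 1\<close> so that \<open>0 \<le> C\<close> already
    makes it strictly positive.\<close>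
  have bound: "(\<Sum>x\<in>S. (\<phi> x)\<^sup>2) \<le> (C + 1) * ?q \<phi> \<phi>" if \<phi>: "\<phi> \<in> l2 S" for \<phi>
  proof -
    have "(\<Sum>y\<in>S. (\<phi> y)\<^sup>2) \<le> (\<Sum>y\<in>S. ?q \<phi> \<phi> * ?q (\<psi> y) (\<psi> y))"
    proof (intro sum_mono)
      fix y assume y: "y \<in> S"
      show "(\<phi> y)\<^sup>2 \<le> ?q \<phi> \<phi> * ?q (\<psi> y) (\<psi> y)"
        using CS[OF \<phi> \<psi>(1)[OF y]] by (simp only: point[OF y])
    qed
    also have "\<dots> = C * ?q \<phi> \<phi>" by (simp add: C_def sum_distrib_left mult.commute)
    also have "\<dots> \<le> (C + 1) * ?q \<phi> \<phi>" using psd[OF \<phi>] by (simp add: algebra_simps)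
    finally show ?thesis .
  qed
  show ?thesis by (rule that[of "C + 1"]) (use C0 bound in auto)
qed

lemma rayleigh_infimum_eigenvalue:
  fixes a :: "'s \<Rightarrow> 's \<Rightarrow> real"
  assumes S: "finite S" "S \<noteq> {}" and sym: "\<And>x y. a x y = a y x"
  obtains m where "\<exists>\<phi>\<in>l2 S. \<phi> \<noteq> (\<lambda>_. 0) \<and> kernel_op S S a \<phi> = (\<lambda>x. m * \<phi> x)"
    and "\<forall>\<phi>\<in>l2 S. m * (\<Sum>x\<in>S. (\<phi> x)\<^sup>2) \<le> (\<Sum>x\<in>S. \<phi> x * kernel_op S S a \<phi> x)"
proof -
  let ?q = "\<lambda>\<phi>. \<Sum>x\<in>S. \<phi> x * kernel_op S S a \<phi> x"
  define R where "R = {?q \<phi> | \<phi>. \<phi> \<in> l2 S \<and> (\<Sum>x\<in>S. (\<phi> x)\<^sup>2) = 1}"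
  \<comment> \<open>The entries of a unit vector have absolute value at most 1, so the sum of all
    absolute entries of \<open>a\<close> bounds the form.\<close>
  have bdd: "bdd_below R"
  proof (rule bdd_belowI)
    fix r assume "r \<in> R"
    then obtain \<phi> where \<phi>: "r = ?q \<phi>" "(\<Sum>x\<in>S. (\<phi> x)\<^sup>2) = 1" by (auto simp: R_def)
    have le: "\<bar>\<phi> x\<bar> \<le> 1" if "x \<in> S" for x
    proof -
      have "(\<phi> x)\<^sup>2 \<le> (\<Sum>x\<in>S. (\<phi> x)\<^sup>2)" using S that by (intro member_le_sum) auto
      then show ?thesis using \<phi>(2) by (simp add: abs_square_le_1)
    qed
    have "\<bar>r\<bar> \<le> (\<Sum>x\<in>S. \<bar>\<phi> x * (\<Sum>y\<in>S. a y x * \<phi> y)\<bar>)"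
      unfolding \<phi>(1) by (simp add: sum_abs)
    also have "\<dots> \<le> (\<Sum>x\<in>S. \<Sum>y\<in>S. \<bar>a y x\<bar>)"
    proof (intro sum_mono)
      fix x assume x: "x \<in> S"
      have "\<bar>\<phi> x * (\<Sum>y\<in>S. a y x * \<phi> y)\<bar> \<le> \<bar>\<Sum>y\<in>S. a y x * \<phi> y\<bar>"
        using le[OF x] by (simp add: abs_mult mult_left_le_one_le)
      also have "\<dots> \<le> (\<Sum>y\<in>S. \<bar>a y x * \<phi> y\<bar>)" by (rule sum_abs)
      also have "\<dots> \<le> (\<Sum>y\<in>S. \<bar>a y x\<bar>)"
        using le by (intro sum_mono) (simp add: abs_mult mult_left_le)
      finally show "\<bar>\<phi> x * (\<Sum>y\<in>S. a y x * \<phi> y)\<bar> \<le> (\<Sum>y\<in>S. \<bar>a y x\<bar>)" .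
    qed
    finally show "- (\<Sum>x\<in>S. \<Sum>y\<in>S. \<bar>a y x\<bar>) \<le> r" by linarith
  qed
  have nonempty: "R \<noteq> {}"
  proof -
    obtain x where x: "x \<in> S" using S by auto
    then have "delta1 x \<in> l2 S" by (auto simp: l2_def delta1_def)
    moreover have "(\<Sum>y\<in>S. (delta1 x y :: real)\<^sup>2) = 1"
      using S(1) x by (simp add: delta1_def if_distrib[of "\<lambda>t. t\<^sup>2"] sum.delta cong: if_cong)
    ultimately show ?thesis by (auto simp: R_def)
  qed
  define m where "m = Inf R"
  have rayleigh: "m * (\<Sum>x\<in>S. (\<phi> x)\<^sup>2) \<le> ?q \<phi>" if \<phi>: "\<phi> \<in> l2 S" for \<phi>
  proof (cases "\<phi> = (\<lambda>_. 0)")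
    case False
    from l2_normalize[OF S(1) \<phi> this] obtain c where
      c: "c \<noteq> 0" "(\<lambda>x. c * \<phi> x) \<in> l2 S" "(\<Sum>x\<in>S. (c * \<phi> x)\<^sup>2) = 1" .
    then have "?q (\<lambda>x. c * \<phi> x) \<in> R" by (auto simp: R_def)
    then have "m \<le> ?q (\<lambda>x. c * \<phi> x)" unfolding m_def using bdd by (rule cInf_lower)
    also have "\<dots> = c\<^sup>2 * ?q \<phi>"
      by (simp only: kernel_op_scale sum_distrib_left) (simp add: power2_eq_square ac_simps)
    finally have "m * (c\<^sup>2 * (\<Sum>x\<in>S. (\<phi> x)\<^sup>2)) \<le> c\<^sup>2 * ?q \<phi>"
      using c(3) by (simp only: power_mult_distrib sum_distrib_left[symmetric])
    then have "c\<^sup>2 * (m * (\<Sum>x\<in>S. (\<phi> x)\<^sup>2)) \<le> c\<^sup>2 * ?q \<phi>" by (simp only: mult.left_commute)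
    then show ?thesis by (rule mult_left_le_imp_le) (use c(1) in simp)
  qed simp
  \<comment> \<open>The kernel of \<open>a - m\<close>, which is semidefinite by
    \<open>rayleigh\<close>.\<close>
  let ?b = "\<lambda>x y. a x y - (if x = y then m else 0)"
  have b: "kernel_op S S ?b \<phi> = (\<lambda>x. kernel_op S S a \<phi> x - m * \<phi> x)" if \<phi>: "\<phi> \<in> l2 S" for \<phi>
  proof (rule l2_eqI[of _ S])
    show "kernel_op S S ?b \<phi> y = kernel_op S S a \<phi> y - m * \<phi> y" if "y \<in> S" for y
      using S that by (simp add: left_diff_distrib sum_subtractf if_distrib[of "\<lambda>t. t * _"] sum.delta cong: if_cong)
  qed (use \<phi> in \<open>auto simp: l2_def kernel_op_def restrict0_def\<close>)
  have form: "(\<Sum>x\<in>S. \<phi> x * kernel_op S S ?b \<phi> x) = ?q \<phi> - m * (\<Sum>x\<in>S. (\<phi> x)\<^sup>2)" if "\<phi> \<in> l2 S" for \<phi>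
    unfolding b[OF that] by (simp add: algebra_simps sum_subtractf sum_distrib_left power2_eq_square del: kernel_op_apply)
  have "\<exists>\<phi>\<in>l2 S. \<phi> \<noteq> (\<lambda>_. 0) \<and> kernel_op S S a \<phi> = (\<lambda>x. m * \<phi> x)"
  proof (rule ccontr)
    assume "\<not> ?thesis"
    then have inj: "\<phi> = (\<lambda>_. 0)" if "\<phi> \<in> l2 S" "kernel_op S S ?b \<phi> = (\<lambda>_. 0)" for \<phi>
      using that by (auto simp: b fun_eq_iff)
    have psd: "0 \<le> (\<Sum>x\<in>S. \<phi> x * kernel_op S S ?b \<phi> x)" if "\<phi> \<in> l2 S" for \<phi>
      using rayleigh[OF that] form[OF that] by linarith
    have "\<And>x y. ?b x y = ?b y x" using sym by auto
    from psd_kernel_coercive[OF S this psd inj] obtain C where C: "0 < C"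
      "\<forall>\<phi>\<in>l2 S. (\<Sum>x\<in>S. (\<phi> x)\<^sup>2) \<le> C * (\<Sum>x\<in>S. \<phi> x * kernel_op S S ?b \<phi> x)" .
    \<comment> \<open>If \<open>m\<close> were no eigenvalue, coercivity would keep every Rayleigh
      quotient at distance \<open>1 / C\<close> above the infimum \<open>m\<close>.\<close>
    have "m + 1 / C \<le> r" if "r \<in> R" for r
    proof -
      from that obtain \<phi> where \<phi>: "r = ?q \<phi>" "\<phi> \<in> l2 S" "(\<Sum>x\<in>S. (\<phi> x)\<^sup>2) = 1" by (auto simp: R_def)
      have "1 \<le> C * (r - m)" using bspec[OF C(2) \<phi>(2)] form[OF \<phi>(2)] \<phi>(1,3) by simp
      then show ?thesis using C(1) by (simp add: field_simps)
    qed
    then have "m + 1 / C \<le> m" unfolding m_def by (intro cInf_greatest nonempty)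
    with C(1) show False by simp
  qed
  with rayleigh show ?thesis by (intro that) auto
qed

text \<open>The Rayleigh infimum is itself an eigenvalue, so the least eigenvalue is at most this
  infimum and inherits it as a lower bound of the form.\<close>

lemma min_spectrum_symmetric:
  fixes a :: "'s \<Rightarrow> 's \<Rightarrow> real"
    and A :: "('s \<Rightarrow> 'a::{field, real_algebra_1}) \<Rightarrow> 's \<Rightarrow> 'a"
  assumes S: "finite S" "S \<noteq> {}" and sym: "\<And>x y. a x y = a y x"
    and A: "\<And>\<phi>. \<phi> \<in> l2 S \<Longrightarrow> A \<phi> = kernel_op S S (\<lambda>x y. of_real (a x y)) \<phi>"
  shows "\<exists>\<phi>\<in>l2 S. \<phi> \<noteq> (\<lambda>_. 0) \<and> kernel_op S S a \<phi> = (\<lambda>x. min_spectrum S A * \<phi> x)" (is ?eigen)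
    and "\<phi> \<in> l2 S \<Longrightarrow> min_spectrum S A * (\<Sum>x\<in>S. (\<phi> x)\<^sup>2) \<le> (\<Sum>x\<in>S. \<phi> x * kernel_op S S a \<phi> x)"
proof -
  define E where "E = {t. \<exists>\<phi>\<in>l2 S. \<phi> \<noteq> (\<lambda>_. 0) \<and> kernel_op S S a \<phi> = (\<lambda>x. t * \<phi> x)}"
  have fin: "finite E" unfolding E_def using S(1) sym by (rule finite_symmetric_eigenvalues)
  have eq: "min_spectrum S A = Min E"
    unfolding min_spectrum_def E_def by (simp add: of_real_in_l2_spectrum_kernel_op[OF S(1) A])
  from rayleigh_infimum_eigenvalue[of S a, OF S sym] obtain m
    where m: "\<exists>\<phi>\<in>l2 S. \<phi> \<noteq> (\<lambda>_. 0) \<and> kernel_op S S a \<phi> = (\<lambda>x. m * \<phi> x)"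
    and rayleigh: "\<forall>\<phi>\<in>l2 S. m * (\<Sum>x\<in>S. (\<phi> x)\<^sup>2) \<le> (\<Sum>x\<in>S. \<phi> x * kernel_op S S a \<phi> x)" .
  from m have m: "m \<in> E" by (simp add: E_def)
  have "min_spectrum S A \<in> E" unfolding eq using fin m by (intro Min_in) auto
  then show ?eigen by (auto simp: E_def)
  have "min_spectrum S A \<le> m" unfolding eq using fin m by (rule Min_le)
  then have "min_spectrum S A * (\<Sum>x\<in>S. (\<phi> x)\<^sup>2) \<le> m * (\<Sum>x\<in>S. (\<phi> x)\<^sup>2)"
    by (intro mult_right_mono sum_nonneg) auto
  also assume "\<phi> \<in> l2 S"
  note bspec[OF rayleigh this]
  finally show "min_spectrum S A * (\<Sum>x\<in>S. (\<phi> x)\<^sup>2) \<le> (\<Sum>x\<in>S. \<phi> x * kernel_op S S a \<phi> x)" .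
qed

subsection \<open>Exterior multiplication by vertices\<close>

text \<open>The operators \<open>ext u\<close> and \<open>con u\<close> are exterior multiplication by the vertex \<open>u\<close> and its adjoint,
  with the signs taken from the incidence numbers \<open>s\<close>; the coboundary of the complete complex is
  the sum of all \<open>ext u\<close>.\<close>

locale incidence =
  fixes V :: "'v set" and s :: "'v set \<Rightarrow> 'v set \<Rightarrow> real"
  assumes finite_V: "finite V"
    and s_square: "\<tau> \<subseteq> V \<Longrightarrow> u \<in> V \<Longrightarrow> u \<notin> \<tau> \<Longrightarrow> s \<tau> (insert u \<tau>) * s \<tau> (insert u \<tau>) = 1"
    and s_zero: "\<tau> \<subseteq> V \<Longrightarrow> \<sigma> \<subseteq> V \<Longrightarrow> \<not> facet_of \<tau> \<sigma> \<Longrightarrow> s \<tau> \<sigma> = 0"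
    and s_anticommute: "\<rho> \<subseteq> V \<Longrightarrow> u \<in> V \<Longrightarrow> v \<in> V \<Longrightarrow> u \<noteq> v \<Longrightarrow> u \<notin> \<rho> \<Longrightarrow> v \<notin> \<rho> \<Longrightarrow>
      s \<rho> (insert u \<rho>) * s (insert u \<rho>) (insert u (insert v \<rho>)) +
      s \<rho> (insert v \<rho>) * s (insert v \<rho>) (insert u (insert v \<rho>)) = 0"
begin

definition ext :: "'v \<Rightarrow> ('v set \<Rightarrow> real) \<Rightarrow> 'v set \<Rightarrow> real" where
  "ext u f \<sigma> = (if u \<in> \<sigma> then s (\<sigma> - {u}) \<sigma> * f (\<sigma> - {u}) else 0)"

definition con :: "'v \<Rightarrow> ('v set \<Rightarrow> real) \<Rightarrow> 'v set \<Rightarrow> real" where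
  "con u f \<tau> = (if u \<in> \<tau> then 0 else s \<tau> (insert u \<tau>) * f (insert u \<tau>))"

definition cobd :: "('v set \<Rightarrow> real) \<Rightarrow> 'v set \<Rightarrow> real" where
  "cobd f \<sigma> = (\<Sum>u\<in>V. ext u f \<sigma>)"

definition bd :: "('v set \<Rightarrow> real) \<Rightarrow> 'v set \<Rightarrow> real" where
  "bd f \<tau> = (\<Sum>u\<in>V. con u f \<tau>)"

text \<open>The anticommutation relation of exterior and interior multiplication. For
  \<open>u = v\<close> exactly one term survives, with a squared sign. For
  \<open>u \<noteq> v\<close> both vanish unless \<open>\<sigma>\<close> contains \<open>u\<close>
  but not \<open>v\<close>, and then they cancel.\<close>

lemma con_ext:
  assumes u: "u \<in> V" and v: "v \<in> V" and \<sigma>: "\<sigma> \<subseteq> V"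
  shows "con v (ext u f) \<sigma> + ext u (con v f) \<sigma> = (if u = v then f \<sigma> else 0)"
proof (cases "u = v")
  case True
  show ?thesis
  proof (cases "u \<in> \<sigma>")
    case True
    then have "\<sigma> - {u} \<subseteq> V" "u \<notin> \<sigma> - {u}" "insert u (\<sigma> - {u}) = \<sigma>" using \<sigma> by auto
    with s_square[of "\<sigma> - {u}" u] True \<open>u = v\<close> u show ?thesis
      by (simp add: con_def ext_def)
  next
    case False
    then have "insert u \<sigma> - {u} = \<sigma>" by auto
    with s_square[of \<sigma> u] False \<open>u = v\<close> u \<sigma> show ?thesis
      by (simp add: con_def ext_def)
  qed
next
  case ne: False
  show ?thesis
  proof (cases "u \<in> \<sigma> \<and> v \<notin> \<sigma>")
    case False
    then show ?thesis using ne by (auto simp: con_def ext_def)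
  next
    case True
    define \<rho> where "\<rho> = \<sigma> - {u}"
    have \<rho>: "\<rho> \<subseteq> V" "u \<notin> \<rho>" "v \<notin> \<rho>" "\<sigma> = insert u \<rho>" using True \<sigma> by (auto simp: \<rho>_def)
    have e: "insert v \<sigma> - {u} = insert v \<rho>" "insert v \<sigma> = insert u (insert v \<rho>)"
      using \<rho> ne by auto
    let ?a = "s \<rho> (insert u \<rho>)" and ?b = "s (insert u \<rho>) (insert u (insert v \<rho>))"
    let ?c = "s \<rho> (insert v \<rho>)" and ?d = "s (insert v \<rho>) (insert u (insert v \<rho>))"
    have aa: "?a * ?a = 1" using \<rho> u by (intro s_square) auto
    have dd: "?d * ?d = 1" using s_square[of "insert v \<rho>" u] \<rho> u v ne by auto
    have "?a * ?b + ?c * ?d = 0" using \<rho> u v ne by (intro s_anticommute) auto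
    \<comment> \<open>The hypothesis compares the two paths from \<open>\<rho>\<close> up to the top
      simplex; the goal compares the two paths from \<open>\<sigma>\<close> to
      \<open>insert v \<rho>\<close>, over the top and over \<open>\<rho>\<close>. The factor
      \<open>?a * ?d\<close> converts one into the other, since \<open>?a\<close> and
      \<open>?d\<close> square to 1.\<close>
    then have "?a * ?d * (?a * ?b + ?c * ?d) = 0" by simp
    then have "(?a * ?a) * (?b * ?d) + (?d * ?d) * (?a * ?c) = 0" by (simp add: algebra_simps)
    then have *: "?b * ?d + ?a * ?c = 0" by (simp add: aa dd)
    have "con v (ext u f) \<sigma> + ext u (con v f) \<sigma> = (?b * ?d + ?a * ?c) * f (insert v \<rho>)"
      using True ne e \<rho> by (simp add: con_def ext_def \<rho>_def[symmetric] algebra_simps)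
    then show ?thesis using * ne by simp
  qed
qed

lemma ext_sum: "ext u (\<lambda>\<sigma>. \<Sum>v\<in>I. g v \<sigma>) \<sigma> = (\<Sum>v\<in>I. ext u (g v) \<sigma>)"
  by (simp add: ext_def sum_distrib_left)

lemma con_sum: "con u (\<lambda>\<sigma>. \<Sum>v\<in>I. g v \<sigma>) \<sigma> = (\<Sum>v\<in>I. con u (g v) \<sigma>)"
  by (simp add: con_def sum_distrib_left)

text \<open>Summing the anticommutation relation over \<open>v\<close> leaves only
  \<open>v = u\<close>. This is the cone construction: multiplication by \<open>u\<close> is a
  contracting homotopy of the complete complex.\<close>

lemma bd_ext:
  assumes "u \<in> V" and "\<sigma> \<subseteq> V"
  shows "bd (ext u f) \<sigma> = f \<sigma> - ext u (bd f) \<sigma>"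
proof -
  have "bd (ext u f) \<sigma> + ext u (bd f) \<sigma> = (\<Sum>v\<in>V. con v (ext u f) \<sigma> + ext u (con v f) \<sigma>)"
    unfolding bd_def[abs_def] ext_sum sum.distrib ..
  also have "\<dots> = f \<sigma>" using assms finite_V by (simp add: con_ext)
  finally show ?thesis by simp
qed

text \<open>Summing the cone identity over all apexes \<open>u\<close> gives one copy of
  \<open>f\<close> per vertex and assembles \<open>ext u\<close> into \<open>cobd\<close>.\<close>

lemma bd_cobd:
  assumes "\<sigma> \<subseteq> V"
  shows "bd (cobd f) \<sigma> + cobd (bd f) \<sigma> = real (card V) * f \<sigma>"
proof -
  have "bd (cobd f) \<sigma> = (\<Sum>u\<in>V. bd (ext u f) \<sigma>)"
    unfolding bd_def cobd_def[abs_def] con_sum by (rule sum.swap)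
  also have "\<dots> = (\<Sum>u\<in>V. f \<sigma> - ext u (bd f) \<sigma>)"
    using assms by (intro sum.cong refl bd_ext)
  finally show ?thesis by (simp add: sum_subtractf cobd_def)
qed

lemma sum_ext_mult:
  assumes u: "u \<in> V"
  shows "(\<Sum>\<sigma>\<in>Pow V. ext u f \<sigma> * g \<sigma>) = (\<Sum>\<tau>\<in>Pow V. f \<tau> * con u g \<tau>)"
proof -
  have "(\<Sum>\<sigma>\<in>Pow V. ext u f \<sigma> * g \<sigma>) = (\<Sum>\<sigma> | \<sigma> \<subseteq> V \<and> u \<in> \<sigma>. ext u f \<sigma> * g \<sigma>)"
    using finite_V by (intro sum.mono_neutral_right) (auto simp: ext_def)
  also have "\<dots> = (\<Sum>\<tau> | \<tau> \<subseteq> V \<and> u \<notin> \<tau>. f \<tau> * con u g \<tau>)"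
    by (rule sum.reindex_bij_witness[of _ "insert u" "\<lambda>\<sigma>. \<sigma> - {u}"])
      (use u in \<open>auto simp: ext_def con_def insert_absorb ac_simps\<close>)
  also have "\<dots> = (\<Sum>\<tau>\<in>Pow V. f \<tau> * con u g \<tau>)"
    using finite_V by (intro sum.mono_neutral_left) (auto simp: con_def)
  finally show ?thesis .
qed

lemma sum_cobd_mult: "(\<Sum>\<sigma>\<in>Pow V. cobd f \<sigma> * g \<sigma>) = (\<Sum>\<tau>\<in>Pow V. f \<tau> * bd g \<tau>)"
proof -
  have "(\<Sum>\<sigma>\<in>Pow V. cobd f \<sigma> * g \<sigma>) = (\<Sum>u\<in>V. \<Sum>\<sigma>\<in>Pow V. ext u f \<sigma> * g \<sigma>)"
    unfolding cobd_def sum_distrib_right by (rule sum.swap)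
  also have "\<dots> = (\<Sum>u\<in>V. \<Sum>\<tau>\<in>Pow V. f \<tau> * con u g \<tau>)" by (simp add: sum_ext_mult)
  also have "\<dots> = (\<Sum>\<tau>\<in>Pow V. f \<tau> * bd g \<tau>)"
    unfolding bd_def sum_distrib_left by (rule sum.swap)
  finally show ?thesis .
qed

section \<open>Matrix form, supports and norms of the exterior operators\<close>

lemma cobd_eq_sum:
  assumes "S \<subseteq> Pow V" and f: "f \<in> l2 S" and \<sigma>: "\<sigma> \<subseteq> V"
  shows "cobd f \<sigma> = (\<Sum>\<tau>\<in>S. s \<tau> \<sigma> * f \<tau>)"
proof -
  have fin: "finite \<sigma>" using \<sigma> finite_V by (rule finite_subset)
  have "cobd f \<sigma> = (\<Sum>u\<in>\<sigma>. s (\<sigma> - {u}) \<sigma> * f (\<sigma> - {u}))"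
    unfolding cobd_def using finite_V \<sigma> by (intro sum.mono_neutral_cong_right) (auto simp: ext_def)
  also have "\<dots> = (\<Sum>\<tau>\<in>(\<lambda>u. \<sigma> - {u}) ` \<sigma>. s \<tau> \<sigma> * f \<tau>)"
    by (rule sum.reindex_cong[symmetric, of "\<lambda>u. \<sigma> - {u}"]) (auto intro!: inj_onI)
  also have "\<dots> = (\<Sum>\<tau>\<in>Pow V. s \<tau> \<sigma> * f \<tau>)"
  proof (rule sum.mono_neutral_left)
    show "\<forall>\<tau>\<in>Pow V - (\<lambda>u. \<sigma> - {u}) ` \<sigma>. s \<tau> \<sigma> * f \<tau> = 0"
    proof
      fix \<tau> assume \<tau>: "\<tau> \<in> Pow V - (\<lambda>u. \<sigma> - {u}) ` \<sigma>"
      have "\<not> facet_of \<tau> \<sigma>"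
      proof
        assume "facet_of \<tau> \<sigma>"
        then obtain u where "\<tau> \<subseteq> \<sigma>" "\<sigma> - \<tau> = {u}" by (auto simp: facet_of_def card_1_singleton_iff)
        then have "u \<in> \<sigma>" "\<tau> = \<sigma> - {u}" by auto
        with \<tau> show False by auto
      qed
      with \<tau> \<sigma> show "s \<tau> \<sigma> * f \<tau> = 0" by (simp add: s_zero)
    qed
  qed (use finite_V \<sigma> in auto)
  also have "\<dots> = (\<Sum>\<tau>\<in>S. s \<tau> \<sigma> * f \<tau>)"
    using finite_V assms(1) f by (intro sum.mono_neutral_right) (auto simp: l2_def)
  finally show ?thesis .
qed

text \<open>Pairing with the point mass at \<open>\<tau>\<close> moves \<open>bd\<close> to
  \<open>cobd\<close>, whose matrix is known, and so yields the transpose.\<close>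

lemma bd_eq_sum:
  assumes S: "S \<subseteq> Pow V" and f: "f \<in> l2 S" and \<tau>: "\<tau> \<subseteq> V"
  shows "bd f \<tau> = (\<Sum>\<sigma>\<in>S. s \<tau> \<sigma> * f \<sigma>)"
proof -
  have "delta1 \<tau> \<in> l2 (Pow V)" using \<tau> by (auto simp: l2_def delta1_def)
  then have c: "cobd (delta1 \<tau>) \<sigma> = s \<tau> \<sigma>" if "\<sigma> \<subseteq> V" for \<sigma>
    using cobd_eq_sum[of "Pow V" "delta1 \<tau>" \<sigma>] that finite_V \<tau>
    by (simp add: delta1_def if_distrib[of "(*) _"] sum.delta cong: if_cong)
  have "bd f \<tau> = (\<Sum>\<rho>\<in>Pow V. delta1 \<tau> \<rho> * bd f \<rho>)"
    using finite_V \<tau> by (simp add: delta1_def if_distrib[of "\<lambda>t. t * _"] sum.delta cong: if_cong)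
  also have "\<dots> = (\<Sum>\<sigma>\<in>Pow V. s \<tau> \<sigma> * f \<sigma>)"
    unfolding sum_cobd_mult[symmetric] by (simp add: c)
  also have "\<dots> = (\<Sum>\<sigma>\<in>S. s \<tau> \<sigma> * f \<sigma>)"
    using finite_V S f by (intro sum.mono_neutral_right) (auto simp: l2_def)
  finally show ?thesis .
qed

lemma bd_add: "bd (\<lambda>\<sigma>. f \<sigma> + g \<sigma>) \<tau> = bd f \<tau> + bd g \<tau>"
  unfolding bd_def sum.distrib[symmetric] by (intro sum.cong refl) (simp add: con_def algebra_simps)

lemma ext_in_l2:
  assumes u: "u \<in> V" and f: "f \<in> l2 (simplices (Pow V) j)"
  shows "ext u f \<in> l2 (simplices (Pow V) (j + 1))"
  unfolding l2_def
proof (intro CollectI allI impI)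
  fix \<sigma> assume \<sigma>: "\<sigma> \<notin> simplices (Pow V) (j + 1)"
  have "\<sigma> - {u} \<notin> simplices (Pow V) j" if "u \<in> \<sigma>"
  proof
    assume *: "\<sigma> - {u} \<in> simplices (Pow V) j"
    then have "finite \<sigma>" "\<sigma> \<subseteq> V" using u by (auto simp: simplices_def)
    moreover have "card \<sigma> = Suc (card (\<sigma> - {u}))"
      using \<open>finite \<sigma>\<close> that by (rule card.remove)
    ultimately show False using \<sigma> * by (simp add: simplices_def)
  qed
  then show "ext u f \<sigma> = 0" using f by (auto simp: ext_def l2_def)
qed

lemma cobd_in_l2:
  assumes "f \<in> l2 (simplices (Pow V) j)"
  shows "cobd f \<in> l2 (simplices (Pow V) (j + 1))"
  using ext_in_l2[OF _ assms] by (auto simp: cobd_def l2_def)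

text \<open>Closure under subsets: if \<open>insert u \<tau>\<close> is a face, so is
  \<open>\<tau>\<close>. Hence \<open>bd\<close> preserves functions on faces without
  truncation.\<close>

lemma bd_in_l2:
  assumes X: "simplicial_complex V X" and f: "f \<in> l2 (simplices X j)"
  shows "bd f \<in> l2 (simplices X (j - 1))"
  unfolding l2_def
proof (intro CollectI allI impI)
  fix \<tau> assume \<tau>: "\<tau> \<notin> simplices X (j - 1)"
  have "con u f \<tau> = 0" for u
  proof -
    have "insert u \<tau> \<notin> simplices X j" if "u \<notin> \<tau>"
      using that \<tau> X by (auto simp: simplices_def simplicial_complex_def)
    then show ?thesis using f by (auto simp: con_def l2_def)
  qed
  then show "bd f \<tau> = 0" by (simp add: bd_def)
qed

text \<open>Each value of \<open>f\<close> at \<open>\<tau>\<close> is copied, up to sign, to the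
  sets \<open>insert u \<tau>\<close>, and the restriction keeps those in \<open>Y\<close>. Taking
  the faces for \<open>Y\<close> produces degrees; \<open>UNIV\<close> produces the number of
  vertices outside \<open>\<tau>\<close>.\<close>

lemma sum_square_restrict_ext:
  "(\<Sum>u\<in>V. \<Sum>\<sigma>\<in>Pow V. (restrict0 Y (ext u f) \<sigma>)\<^sup>2)
    = (\<Sum>\<tau>\<in>Pow V. (f \<tau>)\<^sup>2 * real (card {u \<in> V. u \<notin> \<tau> \<and> insert u \<tau> \<in> Y}))"
proof -
  have "(\<Sum>\<sigma>\<in>Pow V. (restrict0 Y (ext u f) \<sigma>)\<^sup>2)
      = (\<Sum>\<tau>\<in>Pow V. (f \<tau>)\<^sup>2 * (if u \<notin> \<tau> \<and> insert u \<tau> \<in> Y then 1 else 0))" if u: "u \<in> V" for u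
  proof -
    have "(\<Sum>\<sigma>\<in>Pow V. (restrict0 Y (ext u f) \<sigma>)\<^sup>2) = (\<Sum>\<sigma>\<in>Pow V. ext u f \<sigma> * restrict0 Y (ext u f) \<sigma>)"
      by (intro sum.cong refl) (simp add: restrict0_def power2_eq_square)
    also have "\<dots> = (\<Sum>\<tau>\<in>Pow V. f \<tau> * con u (restrict0 Y (ext u f)) \<tau>)"
      using u by (rule sum_ext_mult)
    also have "\<dots> = (\<Sum>\<tau>\<in>Pow V. (f \<tau>)\<^sup>2 * (if u \<notin> \<tau> \<and> insert u \<tau> \<in> Y then 1 else 0))"
    proof (intro sum.cong refl)
      fix \<tau> assume \<tau>: "\<tau> \<in> Pow V"
      show "f \<tau> * con u (restrict0 Y (ext u f)) \<tau> = (f \<tau>)\<^sup>2 * (if u \<notin> \<tau> \<and> insert u \<tau> \<in> Y then 1 else 0)"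
        using s_square[of \<tau> u] u \<tau> by (auto simp: con_def restrict0_def ext_def power2_eq_square)
    qed
    finally show ?thesis .
  qed
  then have "(\<Sum>u\<in>V. \<Sum>\<sigma>\<in>Pow V. (restrict0 Y (ext u f) \<sigma>)\<^sup>2)
      = (\<Sum>u\<in>V. \<Sum>\<tau>\<in>Pow V. (f \<tau>)\<^sup>2 * (if u \<notin> \<tau> \<and> insert u \<tau> \<in> Y then 1 else 0))"
    by simp
  also have "\<dots> = (\<Sum>\<tau>\<in>Pow V. \<Sum>u\<in>V. (f \<tau>)\<^sup>2 * (if u \<notin> \<tau> \<and> insert u \<tau> \<in> Y then 1 else 0))"
    by (rule sum.swap)
  also have "\<dots> = (\<Sum>\<tau>\<in>Pow V. (f \<tau>)\<^sup>2 * real (card {u \<in> V. u \<notin> \<tau> \<and> insert u \<tau> \<in> Y}))"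
    using finite_V by (simp add: sum_distrib_left[symmetric] sum.If_cases Int_def)
  finally show ?thesis .
qed

section \<open>The Hodge Laplacian as \<open>n\<close> minus the part through non-faces\<close>

definition hodge_kernel :: "'v set set \<Rightarrow> int \<Rightarrow> 'v set \<Rightarrow> 'v set \<Rightarrow> real" where
  "hodge_kernel X j \<tau> \<sigma> = (\<Sum>\<rho>\<in>simplices X (j + 1). s \<sigma> \<rho> * s \<tau> \<rho>)
     + (\<Sum>\<rho>\<in>simplices X (j - 1). s \<rho> \<sigma> * s \<rho> \<tau>)"

lemma hodge_kernel_commute: "hodge_kernel X j \<tau> \<sigma> = hodge_kernel X j \<sigma> \<tau>"
  by (simp add: hodge_kernel_def mult.commute)

text \<open>The down part agrees with that of the complete complex, where it is \<open>n\<close>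
  minus the full up part. The up part through faces then cancels, and the part through non-faces
  remains.\<close>

lemma hodge_kernel_op_apply:
  assumes X: "simplicial_complex V X" and \<phi>: "\<phi> \<in> l2 (simplices X j)" and \<sigma>: "\<sigma> \<in> simplices X j"
  shows "kernel_op (simplices X j) (simplices X j) (hodge_kernel X j) \<phi> \<sigma>
    = real (card V) * \<phi> \<sigma> - bd (restrict0 (Pow V - X) (cobd \<phi>)) \<sigma>"
proof -
  have sub: "simplices X i \<subseteq> Pow V" for i using X by (auto simp: simplicial_complex_def simplices_def)
  have \<sigma>V: "\<sigma> \<subseteq> V" using \<sigma> sub by auto
  let ?up = "restrict0 (simplices X (j + 1)) (cobd \<phi>)"
  have "kernel_op (simplices X j) (simplices X j) (hodge_kernel X j) \<phi> \<sigma>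
      = (\<Sum>\<tau>\<in>simplices X j. \<Sum>\<rho>\<in>simplices X (j + 1). s \<sigma> \<rho> * (s \<tau> \<rho> * \<phi> \<tau>))
        + (\<Sum>\<tau>\<in>simplices X j. \<Sum>\<rho>\<in>simplices X (j - 1). s \<rho> \<sigma> * (s \<rho> \<tau> * \<phi> \<tau>))"
    using \<sigma> by (simp add: hodge_kernel_def sum.distrib distrib_right sum_distrib_right mult.assoc)
  also have "(\<Sum>\<tau>\<in>simplices X j. \<Sum>\<rho>\<in>simplices X (j + 1). s \<sigma> \<rho> * (s \<tau> \<rho> * \<phi> \<tau>))
      = (\<Sum>\<rho>\<in>simplices X (j + 1). s \<sigma> \<rho> * (\<Sum>\<tau>\<in>simplices X j. s \<tau> \<rho> * \<phi> \<tau>))"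
    by (subst sum.swap) (simp add: sum_distrib_left)
  also have "\<dots> = (\<Sum>\<rho>\<in>simplices X (j + 1). s \<sigma> \<rho> * ?up \<rho>)"
    using sub[of "j + 1"] by (intro sum.cong refl) (auto simp: restrict0_def cobd_eq_sum[OF sub \<phi>])
  also have "\<dots> = bd ?up \<sigma>"
    by (rule bd_eq_sum[symmetric, OF sub _ \<sigma>V]) (simp add: l2_def restrict0_def)
  also have "(\<Sum>\<tau>\<in>simplices X j. \<Sum>\<rho>\<in>simplices X (j - 1). s \<rho> \<sigma> * (s \<rho> \<tau> * \<phi> \<tau>))
      = (\<Sum>\<rho>\<in>simplices X (j - 1). s \<rho> \<sigma> * (\<Sum>\<tau>\<in>simplices X j. s \<rho> \<tau> * \<phi> \<tau>))"
    by (subst sum.swap) (simp add: sum_distrib_left)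
  also have "\<dots> = (\<Sum>\<rho>\<in>simplices X (j - 1). s \<rho> \<sigma> * bd \<phi> \<rho>)"
    using sub[of "j - 1"] by (intro sum.cong refl) (auto simp: bd_eq_sum[OF sub \<phi>])
  also have "\<dots> = cobd (bd \<phi>) \<sigma>"
    by (rule cobd_eq_sum[symmetric, OF sub bd_in_l2[OF X \<phi>] \<sigma>V])
  also have "cobd (bd \<phi>) \<sigma> = real (card V) * \<phi> \<sigma> - bd (cobd \<phi>) \<sigma>"
    using bd_cobd[OF \<sigma>V, of \<phi>] by simp
  also have "bd (cobd \<phi>) \<sigma> = bd ?up \<sigma> + bd (restrict0 (Pow V - X) (cobd \<phi>)) \<sigma>"
  proof -
    have "\<phi> \<in> l2 (simplices (Pow V) j)" using \<phi> X by (auto simp: l2_def simplices_def simplicial_complex_def)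
    then have "cobd \<phi> \<in> l2 (simplices (Pow V) (j + 1))" by (rule cobd_in_l2)
    \<comment> \<open>As \<open>cobd \<phi>\<close> lives in dimension \<open>j + 1\<close>, its
      restriction to the \<open>(j + 1)\<close>-simplices of \<open>X\<close> is its restriction to
      all faces.\<close>
    then have "cobd \<phi> = (\<lambda>\<rho>. ?up \<rho> + restrict0 (Pow V - X) (cobd \<phi>) \<rho>)"
      using X by (auto simp: fun_eq_iff restrict0_def l2_def simplices_def simplicial_complex_def)
    then show ?thesis using bd_add by metis
  qed
  finally show ?thesis by simp
qed

text \<open>Adjointness moves \<open>bd\<close> onto \<open>\<phi>\<close>, and the restriction is a
  projection. So a lower bound for the spectrum is an upper bound for the coboundary on
  non-faces.\<close>

lemma hodge_kernel_form:
  assumes X: "simplicial_complex V X" and \<phi>: "\<phi> \<in> l2 (simplices X j)"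
  shows "(\<Sum>\<sigma>\<in>simplices X j. \<phi> \<sigma> * kernel_op (simplices X j) (simplices X j) (hodge_kernel X j) \<phi> \<sigma>)
    = real (card V) * (\<Sum>\<sigma>\<in>Pow V. (\<phi> \<sigma>)\<^sup>2) - (\<Sum>\<sigma>\<in>Pow V. (restrict0 (Pow V - X) (cobd \<phi>) \<sigma>)\<^sup>2)"
proof -
  have sub: "simplices X j \<subseteq> Pow V" using X by (auto simp: simplicial_complex_def simplices_def)
  let ?\<psi> = "restrict0 (Pow V - X) (cobd \<phi>)"
  have "(\<Sum>\<sigma>\<in>simplices X j. \<phi> \<sigma> * kernel_op (simplices X j) (simplices X j) (hodge_kernel X j) \<phi> \<sigma>)
      = (\<Sum>\<sigma>\<in>simplices X j. real (card V) * (\<phi> \<sigma>)\<^sup>2 - \<phi> \<sigma> * bd ?\<psi> \<sigma>)"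
    by (intro sum.cong refl)
      (simp add: hodge_kernel_op_apply[OF X \<phi>] right_diff_distrib power2_eq_square del: kernel_op_apply)
  also have "\<dots> = (\<Sum>\<sigma>\<in>Pow V. real (card V) * (\<phi> \<sigma>)\<^sup>2 - \<phi> \<sigma> * bd ?\<psi> \<sigma>)"
    using finite_V sub \<phi> by (intro sum.mono_neutral_left) (auto simp: l2_def)
  also have "\<dots> = real (card V) * (\<Sum>\<sigma>\<in>Pow V. (\<phi> \<sigma>)\<^sup>2) - (\<Sum>\<sigma>\<in>Pow V. cobd \<phi> \<sigma> * ?\<psi> \<sigma>)"
    by (simp add: sum_subtractf sum_distrib_left sum_cobd_mult)
  also have "(\<Sum>\<sigma>\<in>Pow V. cobd \<phi> \<sigma> * ?\<psi> \<sigma>) = (\<Sum>\<sigma>\<in>Pow V. (?\<psi> \<sigma>)\<^sup>2)"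
    by (intro sum.cong refl) (simp add: restrict0_def power2_eq_square)
  finally show ?thesis .
qed

text \<open>The vector \<open>\<psi>\<close> below lives on the non-faces of dimension \<open>k + 1\<close>. Since non-faces are closed
  under supersets, its products with the vertices live on the non-faces of dimension \<open>k + 2\<close>,
  and by \<open>bd_ext\<close> their boundaries, restricted to faces, are multiples of products with \<open>\<phi>\<close>.\<close>

lemma degree_times_defect_le:
  assumes X: "simplicial_complex V X" and \<phi>: "\<phi> \<in> l2 (simplices X k)" "\<phi> \<noteq> (\<lambda>_. 0)"
    and eigen: "\<And>\<sigma>. \<sigma> \<in> simplices X k \<Longrightarrow> bd (restrict0 (Pow V - X) (cobd \<phi>)) \<sigma> = \<nu> * \<phi> \<sigma>"
    and bound: "\<And>\<chi>. \<chi> \<in> l2 (simplices X (k + 1)) \<Longrightarrow>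
      (\<Sum>\<sigma>\<in>Pow V. (restrict0 (Pow V - X) (cobd \<chi>) \<sigma>)\<^sup>2) \<le> \<nu>' * (\<Sum>\<sigma>\<in>Pow V. (\<chi> \<sigma>)\<^sup>2)"
    and \<nu>': "0 \<le> \<nu>'"
    and degree: "\<And>\<tau>. \<tau> \<in> simplices X k \<Longrightarrow> d \<le> real (card {u \<in> V. u \<notin> \<tau> \<and> insert u \<tau> \<in> X})"
    and k: "k + 2 \<le> int (card V)"
  shows "d * \<nu> \<le> (real (card V) - real_of_int k - 2) * \<nu>'"
proof -
  define N where "N f = (\<Sum>\<sigma>\<in>Pow V. (f \<sigma>)\<^sup>2)" for f :: "'v set \<Rightarrow> real"
  define Q where "Q f = restrict0 (Pow V - X) (cobd f)" for f
  define \<psi> where "\<psi> = Q \<phi>"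
  define \<chi> where "\<chi> u = restrict0 X (bd (ext u \<psi>))" for u
  define m where "m = real (card V) - real_of_int k - 2"
  have XV: "X \<subseteq> Pow V" and down: "\<And>\<sigma> \<tau>. \<sigma> \<in> X \<Longrightarrow> \<tau> \<subseteq> \<sigma> \<Longrightarrow> \<tau> \<in> X"
    using X by (auto simp: simplicial_complex_def)
  have N_nonneg: "0 \<le> N f" for f unfolding N_def by (intro sum_nonneg) auto
  have \<phi>V: "\<phi> \<in> l2 (simplices (Pow V) k)" using \<phi>(1) XV by (auto simp: l2_def simplices_def)
  have \<phi>X: "\<phi> \<sigma> = 0" if "\<sigma> \<notin> X" for \<sigma> using \<phi>(1) that by (auto simp: l2_def simplices_def)
  have \<psi>V: "\<psi> \<in> l2 (simplices (Pow V) (k + 1))"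
    using cobd_in_l2[OF \<phi>V] by (auto simp: \<psi>_def Q_def restrict0_def l2_def)
  have \<psi>X: "\<psi> \<sigma> = 0" if "\<sigma> \<in> X" for \<sigma> using that by (simp add: \<psi>_def Q_def restrict0_def)
  have bd_\<psi>: "bd \<psi> \<tau> = \<nu> * \<phi> \<tau>" if "\<tau> \<in> X" for \<tau>
  proof (cases "\<tau> \<in> simplices X k")
    case True
    then show ?thesis using eigen by (simp add: \<psi>_def Q_def)
  next
    case False
    \<comment> \<open>Outside dimension \<open>k\<close> both sides vanish, because
      \<open>\<psi>\<close> lives in dimension \<open>k + 1\<close>.\<close>
    have "simplicial_complex V (Pow V)" by (auto simp: simplicial_complex_def)
    from bd_in_l2[OF this \<psi>V] have "bd \<psi> \<in> l2 (simplices (Pow V) k)" by simp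
    then have "bd \<psi> \<tau> = 0" using False that by (auto simp: l2_def simplices_def)
    then show ?thesis using False \<phi>(1) by (auto simp: l2_def)
  qed
  have N_\<psi>: "N \<psi> = \<nu> * N \<phi>"
  proof -
    have "N \<psi> = (\<Sum>\<sigma>\<in>Pow V. cobd \<phi> \<sigma> * \<psi> \<sigma>)"
      unfolding N_def by (intro sum.cong refl) (simp add: \<psi>_def Q_def restrict0_def power2_eq_square)
    also have "\<dots> = (\<Sum>\<sigma>\<in>Pow V. \<phi> \<sigma> * bd \<psi> \<sigma>)" by (rule sum_cobd_mult)
    also have "\<dots> = (\<Sum>\<sigma>\<in>Pow V. \<nu> * (\<phi> \<sigma>)\<^sup>2)"
    proof (intro sum.cong refl)
      show "\<phi> \<sigma> * bd \<psi> \<sigma> = \<nu> * (\<phi> \<sigma>)\<^sup>2" for \<sigma>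
        using bd_\<psi>[of \<sigma>] \<phi>X[of \<sigma>] by (cases "\<sigma> \<in> X") (auto simp: power2_eq_square)
    qed
    finally show ?thesis by (simp add: N_def sum_distrib_left)
  qed
  \<comment> \<open>On a face \<open>\<sigma>\<close> the function \<open>\<psi>\<close> vanishes,
    and \<open>\<sigma> - {u}\<close> is again a face, so only the term
    \<open>- ext u (bd \<psi>)\<close> of the cone identity remains.\<close>
  have \<chi>_eq: "\<chi> u \<sigma> = - \<nu> * restrict0 X (ext u \<phi>) \<sigma>" if "u \<in> V" for u \<sigma>
  proof (cases "\<sigma> \<in> X")
    case True
    then have "\<sigma> \<subseteq> V" "\<sigma> - {u} \<in> X" using XV down by auto
    with True bd_ext[OF that, of \<sigma> \<psi>] bd_\<psi>[of "\<sigma> - {u}"] show ?thesis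
      by (simp add: \<chi>_def restrict0_def \<psi>X ext_def)
  qed (simp add: \<chi>_def restrict0_def)
  \<comment> \<open>An operator and its adjoint share their norm: \<open>N (\<chi> u)\<close> is the
    pairing of \<open>Q (\<chi> u)\<close> with \<open>ext u \<psi>\<close>, so Cauchy-Schwarz and
    \<open>bound\<close> apply and one factor \<open>N (\<chi> u)\<close> cancels.\<close>
  have \<chi>_le: "N (\<chi> u) \<le> \<nu>' * N (ext u \<psi>)" if u: "u \<in> V" for u
  proof -
    have "restrict0 X (ext u \<phi>) \<in> l2 (simplices X (k + 1))"
      using ext_in_l2[OF u \<phi>V] by (auto simp: restrict0_def l2_def simplices_def)
    then have "\<chi> u \<in> l2 (simplices X (k + 1))" by (auto simp: l2_def \<chi>_eq[OF u])
    then have b: "N (Q (\<chi> u)) \<le> \<nu>' * N (\<chi> u)" unfolding N_def Q_def by (rule bound)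
    have "N (\<chi> u) = (\<Sum>\<sigma>\<in>Pow V. \<chi> u \<sigma> * bd (ext u \<psi>) \<sigma>)"
      unfolding N_def by (intro sum.cong refl) (simp add: \<chi>_def restrict0_def power2_eq_square)
    also have "\<dots> = (\<Sum>\<sigma>\<in>Pow V. cobd (\<chi> u) \<sigma> * ext u \<psi> \<sigma>)" by (rule sum_cobd_mult[symmetric])
    also have "\<dots> = (\<Sum>\<sigma>\<in>Pow V. Q (\<chi> u) \<sigma> * ext u \<psi> \<sigma>)"
    proof (intro sum.cong refl)
      fix \<sigma> assume "\<sigma> \<in> Pow V"
      moreover have "ext u \<psi> \<sigma> = 0" if "\<sigma> \<in> X"
        using \<psi>X[of "\<sigma> - {u}"] down[OF that, of "\<sigma> - {u}"] by (simp add: ext_def)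
      ultimately show "cobd (\<chi> u) \<sigma> * ext u \<psi> \<sigma> = Q (\<chi> u) \<sigma> * ext u \<psi> \<sigma>"
        by (auto simp: Q_def restrict0_def)
    qed
    finally have "(N (\<chi> u))\<^sup>2 \<le> N (Q (\<chi> u)) * N (ext u \<psi>)"
      unfolding N_def by (simp only: Cauchy_Schwarz_ineq_sum)
    also have "\<dots> \<le> \<nu>' * N (\<chi> u) * N (ext u \<psi>)" using b N_nonneg by (rule mult_right_mono)
    finally have "N (\<chi> u) * N (\<chi> u) \<le> N (\<chi> u) * (\<nu>' * N (ext u \<psi>))"
      by (simp add: power2_eq_square ac_simps)
    then show ?thesis
      using N_nonneg[of "\<chi> u"] N_nonneg[of "ext u \<psi>"] \<nu>'
      by (cases "N (\<chi> u) = 0") (auto simp: mult_le_cancel_left)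
  qed
  \<comment> \<open>The sum of all \<open>N (\<chi> u)\<close> is estimated from below through
    \<open>\<chi>_eq\<close> and the degrees, and from above through
    \<open>\<chi>_le\<close>.\<close>
  have "d * \<nu>\<^sup>2 * N \<phi> = \<nu>\<^sup>2 * (\<Sum>\<tau>\<in>Pow V. (\<phi> \<tau>)\<^sup>2 * d)"
    by (simp add: N_def sum_distrib_left sum_distrib_right ac_simps)
  also have "\<dots> \<le> \<nu>\<^sup>2 * (\<Sum>\<tau>\<in>Pow V. (\<phi> \<tau>)\<^sup>2 * real (card {u \<in> V. u \<notin> \<tau> \<and> insert u \<tau> \<in> X}))"
  proof (rule mult_left_mono[OF sum_mono])
    show "(\<phi> \<tau>)\<^sup>2 * d \<le> (\<phi> \<tau>)\<^sup>2 * real (card {u \<in> V. u \<notin> \<tau> \<and> insert u \<tau> \<in> X})" for \<tau>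
      using degree[of \<tau>] \<phi>(1) by (cases "\<tau> \<in> simplices X k") (auto simp: l2_def intro!: mult_left_mono)
  qed auto
  also have "\<dots> = \<nu>\<^sup>2 * (\<Sum>u\<in>V. N (restrict0 X (ext u \<phi>)))"
    unfolding N_def sum_square_restrict_ext ..
  also have "\<dots> = (\<Sum>u\<in>V. N (\<chi> u))"
    by (simp add: N_def \<chi>_eq power_mult_distrib sum_distrib_left)
  also have "\<dots> \<le> (\<Sum>u\<in>V. \<nu>' * N (ext u \<psi>))" by (intro sum_mono \<chi>_le)
  also have "\<dots> = \<nu>' * (\<Sum>\<tau>\<in>Pow V. (\<psi> \<tau>)\<^sup>2 * real (card {u \<in> V. u \<notin> \<tau>}))"
    using sum_square_restrict_ext[of UNIV \<psi>] by (simp add: N_def restrict0_def flip: sum_distrib_left)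
  also have "(\<Sum>\<tau>\<in>Pow V. (\<psi> \<tau>)\<^sup>2 * real (card {u \<in> V. u \<notin> \<tau>})) = (\<Sum>\<tau>\<in>Pow V. m * (\<psi> \<tau>)\<^sup>2)"
  proof (intro sum.cong refl)
    fix \<tau> assume \<tau>: "\<tau> \<in> Pow V"
    show "(\<psi> \<tau>)\<^sup>2 * real (card {u \<in> V. u \<notin> \<tau>}) = m * (\<psi> \<tau>)\<^sup>2"
    proof (cases "\<psi> \<tau> = 0")
      case False
      then have "\<tau> \<in> simplices (Pow V) (k + 1)" using \<psi>V by (auto simp: l2_def)
      \<comment> \<open>Dimension \<open>k + 1\<close> means \<open>k + 2\<close> vertices, which
        leaves \<open>n - k - 2\<close> vertices for \<open>u\<close>.\<close>
      then have "int (card \<tau>) = k + 2" by (simp add: simplices_def)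
      moreover have "{u \<in> V. u \<notin> \<tau>} = V - \<tau>" by auto
      moreover have "card (V - \<tau>) = card V - card \<tau>" "card \<tau> \<le> card V"
        using \<tau> finite_V by (auto simp: card_Diff_subset finite_subset card_mono)
      ultimately have "real (card {u \<in> V. u \<notin> \<tau>}) = m" by (simp add: m_def of_nat_diff)
      then show ?thesis by simp
    qed simp
  qed
  also have "\<nu>' * \<dots> = m * \<nu>' * (\<nu> * N \<phi>)"
    by (simp add: N_def[symmetric] sum_distrib_left[symmetric] N_\<psi>)
  finally have *: "d * \<nu>\<^sup>2 * N \<phi> \<le> m * \<nu>' * (\<nu> * N \<phi>)" .
  have "0 < N \<phi>"
    unfolding N_def by (rule l2_sum_squares_pos) (use \<phi> XV finite_V in \<open>auto simp: l2_def simplices_def\<close>)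
  moreover from this have "0 \<le> \<nu>" using N_nonneg[of \<psi>] N_\<psi> by (simp add: zero_le_mult_iff)
  moreover have "0 \<le> m * \<nu>'" using k \<nu>' by (simp add: m_def)
  \<comment> \<open>For \<open>\<nu> > 0\<close> the factor \<open>\<nu> * N \<phi>\<close> cancels;
    for \<open>\<nu> = 0\<close> the claim reduces to \<open>0 \<le> m * \<nu>'\<close>.\<close>
  moreover have "(\<nu> * N \<phi>) * (d * \<nu>) \<le> (\<nu> * N \<phi>) * (m * \<nu>')"
    using * by (simp add: power2_eq_square ac_simps)
  ultimately show ?thesis
    unfolding m_def by (cases "\<nu> = 0") (auto dest: mult_left_le_imp_le)
qed

end

subsection \<open>Reduction to real incidence numbers\<close>

text \<open>A real copy of the signs of \<open>D\<close>, in the dimension read off from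
  \<open>card \<tau>\<close>. The facet test comes first so that the number vanishes on all
  non-facets, also where \<open>coboundary_operators\<close> says nothing.\<close>

definition incidence_number ::
  "(int \<Rightarrow> ('v set \<Rightarrow> 'a::comm_ring_1) \<Rightarrow> 'v set \<Rightarrow> 'a) \<Rightarrow> 'v set \<Rightarrow> 'v set \<Rightarrow> real" where
  "incidence_number D \<tau> \<sigma> = (if \<not> facet_of \<tau> \<sigma> then 0
     else if D (int (card \<tau>) - 1) (delta1 \<tau>) \<sigma> = 1 then 1 else -1)"

lemma facet_of_insert: "u \<notin> \<tau> \<Longrightarrow> facet_of \<tau> (insert u \<tau>)"
  by (auto simp: facet_of_def insert_Diff_if)

lemma of_real_incidence_number:
  fixes D :: "int \<Rightarrow> ('v set \<Rightarrow> 'a::{comm_ring_1, real_algebra_1}) \<Rightarrow> 'v set \<Rightarrow> 'a"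
  assumes "coboundary_operators Y D" and "-1 \<le> k"
    and "\<tau> \<in> simplices Y k" and "\<sigma> \<in> simplices Y (k + 1)"
  shows "D k (delta1 \<tau>) \<sigma> = of_real (incidence_number D \<tau> \<sigma>)"
proof -
  have "int (card \<tau>) - 1 = k" using assms(3) by (simp add: simplices_def)
  moreover have "D k (delta1 \<tau>) \<sigma> \<in> {1, -1, 0} \<and> (D k (delta1 \<tau>) \<sigma> \<noteq> 0 \<longleftrightarrow> facet_of \<tau> \<sigma>)"
    using assms unfolding coboundary_operators_def by blast
  ultimately show ?thesis by (auto simp: incidence_number_def)
qed

text \<open>The anticommutation axiom is \<open>\<delta> \<delta> = 0\<close>, applied to the point
  mass at \<open>\<rho>\<close> and read at \<open>\<rho>\<close> with \<open>u\<close> and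
  \<open>v\<close> added: exactly two simplices lie in between.\<close>

lemma incidence_incidence_number:
  fixes D :: "int \<Rightarrow> ('v set \<Rightarrow> 'a::{comm_ring_1, real_algebra_1}) \<Rightarrow> 'v set \<Rightarrow> 'a"
  assumes V: "finite V" and D: "coboundary_operators (Pow V) D"
  shows "incidence V (incidence_number D)"
proof
  let ?s = "incidence_number D" and ?K = "simplices (Pow V)"
  have finK: "finite (?K k)" for k using V by (simp add: simplices_def)
  fix \<rho> u v assume *: "\<rho> \<subseteq> V" "u \<in> V" "v \<in> V" "u \<noteq> v" "u \<notin> \<rho>" "v \<notin> \<rho>"
  let ?\<sigma> = "insert u (insert v \<rho>)"
  define k where "k = int (card \<rho>) - 1"
  have fin: "finite \<rho>" using *(1) V by (rule finite_subset)
  have mem: "\<rho> \<in> ?K k" "insert u \<rho> \<in> ?K (k + 1)" "insert v \<rho> \<in> ?K (k + 1)" "?\<sigma> \<in> ?K (k + 1 + 1)"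
    using * fin by (auto simp: simplices_def k_def)
  have k: "-1 \<le> k" "-1 \<le> k + 1" by (auto simp: k_def)
  have d: "delta1 \<rho> \<in> l2 (?K k)" using mem(1) by (auto simp: l2_def delta1_def)
  have lin: "l2_linear (?K j) (?K (j + 1)) (D j)" if "-1 \<le> j" for j
    using D that unfolding coboundary_operators_def by blast
  have "D k (delta1 \<rho>) \<in> l2 (?K (k + 1))" using lin[OF k(1)] d unfolding l2_linear_def by blast
  from l2_linear_eq_kernel_op[OF lin[OF k(2)] finK this]
  have "D (k + 1) (D k (delta1 \<rho>)) ?\<sigma> = (\<Sum>\<tau>\<in>?K (k + 1). D (k + 1) (delta1 \<tau>) ?\<sigma> * D k (delta1 \<rho>) \<tau>)"
    using mem(4) by simp
  also have "\<dots> = (\<Sum>\<tau>\<in>?K (k + 1). of_real (?s \<tau> ?\<sigma> * ?s \<rho> \<tau>))"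
    by (intro sum.cong refl)
      (simp add: of_real_incidence_number[OF D k(2) _ mem(4)] of_real_incidence_number[OF D k(1) mem(1)])
  also have "D (k + 1) (D k (delta1 \<rho>)) = (\<lambda>_. 0)"
    using D k(1) d unfolding coboundary_operators_def by blast
  finally have "of_real (\<Sum>\<tau>\<in>?K (k + 1). ?s \<tau> ?\<sigma> * ?s \<rho> \<tau>) = (0 :: 'a)" by simp
  then have "(\<Sum>\<tau>\<in>?K (k + 1). ?s \<tau> ?\<sigma> * ?s \<rho> \<tau>) = 0" by (simp only: of_real_eq_0_iff)
  also have "(\<Sum>\<tau>\<in>?K (k + 1). ?s \<tau> ?\<sigma> * ?s \<rho> \<tau>) = (\<Sum>\<tau>\<in>{insert u \<rho>, insert v \<rho>}. ?s \<tau> ?\<sigma> * ?s \<rho> \<tau>)"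
  proof (rule sum.mono_neutral_right)
    show "\<forall>\<tau>\<in>?K (k + 1) - {insert u \<rho>, insert v \<rho>}. ?s \<tau> ?\<sigma> * ?s \<rho> \<tau> = 0"
    proof
      fix \<tau> assume \<tau>: "\<tau> \<in> ?K (k + 1) - {insert u \<rho>, insert v \<rho>}"
      have "\<not> (facet_of \<tau> ?\<sigma> \<and> facet_of \<rho> \<tau>)"
      proof
        assume f: "facet_of \<tau> ?\<sigma> \<and> facet_of \<rho> \<tau>"
        then obtain w where w: "\<rho> \<subseteq> \<tau>" "\<tau> - \<rho> = {w}" by (auto simp: facet_of_def card_1_singleton_iff)
        then have "\<tau> = insert w \<rho>" "w \<in> \<tau>" "w \<notin> \<rho>" by auto
        moreover have "\<tau> \<subseteq> ?\<sigma>" using f by (simp add: facet_of_def)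
        ultimately show False using \<tau> by auto
      qed
      then show "?s \<tau> ?\<sigma> * ?s \<rho> \<tau> = 0" by (auto simp: incidence_number_def)
    qed
  qed (use mem finK in auto)
  also have "\<dots> = ?s (insert u \<rho>) ?\<sigma> * ?s \<rho> (insert u \<rho>) + ?s (insert v \<rho>) ?\<sigma> * ?s \<rho> (insert v \<rho>)"
    using * by (subst sum.insert) (auto simp: insert_eq_iff)
  finally show "?s \<rho> (insert u \<rho>) * ?s (insert u \<rho>) ?\<sigma> + ?s \<rho> (insert v \<rho>) * ?s (insert v \<rho>) ?\<sigma> = 0"
    by (simp add: mult.commute)
qed (auto simp: V incidence_number_def facet_of_insert)

text \<open>\<open>conjugate 1\<close> is idempotent by multiplicativity and nonzero, hence 1 in a
  field; the other values follow from additivity.\<close>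

lemma conjugate_incidence_number:
  "conjugate (of_real (incidence_number D \<tau> \<sigma>)) =
    (of_real (incidence_number D \<tau> \<sigma>) :: 'a::{conjugatable_ordered_field, real_normed_field})"
proof -
  have "conjugate 1 * conjugate 1 = (conjugate 1 :: 'a)"
    using conjugate_dist_mul[of 1 "1 :: 'a"] by simp
  then have 1: "conjugate 1 = (1 :: 'a)" by simp
  then show ?thesis by (auto simp: incidence_number_def conjugate_neg)
qed

text \<open>Extension by zero is an inclusion here, so \<open>\<phi>\<close> is also a function on
  the complete complex; the terms off \<open>X\<close> drop out of the sum.\<close>

lemma coboundary_eq_kernel_op:
  fixes D :: "int \<Rightarrow> ('v set \<Rightarrow> 'a::{comm_ring_1, real_algebra_1}) \<Rightarrow> 'v set \<Rightarrow> 'a"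
  assumes V: "finite V" and D: "coboundary_operators (Pow V) D" and X: "X \<subseteq> Pow V"
    and k: "-1 \<le> k" and \<phi>: "\<phi> \<in> l2 (simplices X k)"
  shows "coboundary X D k \<phi>
    = kernel_op (simplices X k) (simplices X (k + 1)) (\<lambda>\<tau> \<sigma>. of_real (incidence_number D \<tau> \<sigma>)) \<phi>"
proof (rule l2_eqI)
  let ?K = "simplices (Pow V)"
  have finK: "finite (?K k)" using V by (simp add: simplices_def)
  have sub: "simplices X j \<subseteq> ?K j" for j using X by (auto simp: simplices_def)
  fix \<sigma> assume \<sigma>: "\<sigma> \<in> simplices X (k + 1)"
  then have \<sigma>K: "\<sigma> \<in> ?K (k + 1)" using sub by auto
  have "l2_linear (?K k) (?K (k + 1)) (D k)"
    using D k unfolding coboundary_operators_def by blast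
  moreover have "\<phi> \<in> l2 (?K k)" using \<phi> sub by (auto simp: l2_def)
  ultimately have "D k \<phi> \<sigma> = (\<Sum>\<tau>\<in>?K k. D k (delta1 \<tau>) \<sigma> * \<phi> \<tau>)"
    using l2_linear_eq_kernel_op[OF _ finK, of "?K (k + 1)" "D k" \<phi>] \<sigma>K by simp
  also have "\<dots> = (\<Sum>\<tau>\<in>?K k. of_real (incidence_number D \<tau> \<sigma>) * \<phi> \<tau>)"
    by (intro sum.cong refl) (simp add: of_real_incidence_number[OF D k _ \<sigma>K])
  also have "\<dots> = (\<Sum>\<tau>\<in>simplices X k. of_real (incidence_number D \<tau> \<sigma>) * \<phi> \<tau>)"
    using finK sub \<phi> by (intro sum.mono_neutral_right) (auto simp: l2_def)
  finally show "coboundary X D k \<phi> \<sigma> = kernel_op (simplices X k) (simplices X (k + 1))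
      (\<lambda>\<tau> \<sigma>. of_real (incidence_number D \<tau> \<sigma>)) \<phi> \<sigma>"
    using \<sigma> by (simp add: coboundary_def restrict0_def)
qed (auto simp: coboundary_def restrict0_def l2_def kernel_op_def)

text \<open>Both parts are products of the incidence matrix and its transpose. With
  \<open>0 \<le> k\<close> the lower coboundary has index at least \<open>-1\<close>, where
  \<open>D\<close> is specified.\<close>

lemma hodge_laplacian_eq_kernel_op:
  fixes D :: "int \<Rightarrow> ('v set \<Rightarrow> 'a::{conjugatable_ordered_field, real_normed_field}) \<Rightarrow> 'v set \<Rightarrow> 'a"
  assumes V: "finite V" and D: "coboundary_operators (Pow V) D" and X: "X \<subseteq> Pow V"
    and k: "0 \<le> k" and \<phi>: "\<phi> \<in> l2 (simplices X k)"
  shows "hodge_laplacian X D k \<phi> = kernel_op (simplices X k) (simplices X k)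
    (\<lambda>\<tau> \<sigma>. of_real (incidence.hodge_kernel (incidence_number D) X k \<tau> \<sigma>)) \<phi>"
proof -
  interpret incidence V "incidence_number D" using V D by (rule incidence_incidence_number)
  let ?s = "\<lambda>\<tau> \<sigma>. of_real (incidence_number D \<tau> \<sigma>) :: 'a"
  have fin: "finite (simplices X j)" for j
    using V X by (intro finite_subset[of "simplices X j" "Pow V"]) (auto simp: simplices_def)
  have cob: "coboundary X D j \<psi> = kernel_op (simplices X j) (simplices X (j + 1)) ?s \<psi>"
    if "-1 \<le> j" "\<psi> \<in> l2 (simplices X j)" for j \<psi>
    using V D X that by (rule coboundary_eq_kernel_op)
  have bnd: "boundary X D j \<psi> = kernel_op (simplices X (j + 1)) (simplices X j) (\<lambda>\<sigma> \<tau>. ?s \<tau> \<sigma>) \<psi>"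
    if "-1 \<le> j" for j \<psi>
    unfolding boundary_def using fin fin cob[OF that] conjugate_incidence_number
    by (rule l2_adjoint_kernel_op)
  have bnd': "boundary X D (k - 1) \<phi> \<in> l2 (simplices X (k - 1))" using bnd[of "k - 1"] k by simp
  show ?thesis
  proof (rule l2_eqI)
    show "hodge_laplacian X D k \<phi> \<in> l2 (simplices X k)"
      using k bnd' by (auto simp: hodge_laplacian_def l2_def bnd coboundary_def kernel_op_def restrict0_def)
    fix \<sigma> assume \<sigma>: "\<sigma> \<in> simplices X k"
    have "boundary X D k (coboundary X D k \<phi>) \<sigma>
        = (\<Sum>\<rho>\<in>simplices X (k + 1). ?s \<sigma> \<rho> * (\<Sum>\<tau>\<in>simplices X k. ?s \<tau> \<rho> * \<phi> \<tau>))"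
      using \<sigma> k \<phi> by (simp add: bnd cob)
    also have "\<dots> = (\<Sum>\<tau>\<in>simplices X k. (\<Sum>\<rho>\<in>simplices X (k + 1). ?s \<sigma> \<rho> * ?s \<tau> \<rho>) * \<phi> \<tau>)"
      unfolding sum_distrib_left sum_distrib_right mult.assoc by (rule sum.swap)
    finally have up: "boundary X D k (coboundary X D k \<phi>) \<sigma> = \<dots>" .
    have "coboundary X D (k - 1) (boundary X D (k - 1) \<phi>) \<sigma>
        = (\<Sum>\<rho>\<in>simplices X (k - 1). ?s \<rho> \<sigma> * boundary X D (k - 1) \<phi> \<rho>)"
      using \<sigma> k by (simp add: cob[OF _ bnd'])
    also have "\<dots> = (\<Sum>\<rho>\<in>simplices X (k - 1). ?s \<rho> \<sigma> * (\<Sum>\<tau>\<in>simplices X k. ?s \<rho> \<tau> * \<phi> \<tau>))"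
      using k bnd[of "k - 1"] by simp
    also have "\<dots> = (\<Sum>\<tau>\<in>simplices X k. (\<Sum>\<rho>\<in>simplices X (k - 1). ?s \<rho> \<sigma> * ?s \<rho> \<tau>) * \<phi> \<tau>)"
      unfolding sum_distrib_left sum_distrib_right mult.assoc by (rule sum.swap)
    finally show "hodge_laplacian X D k \<phi> \<sigma> = kernel_op (simplices X k) (simplices X k)
        (\<lambda>\<tau> \<sigma>. of_real (hodge_kernel X k \<tau> \<sigma>)) \<phi> \<sigma>"
      using \<sigma> up by (simp add: hodge_laplacian_def hodge_kernel_def distrib_right sum.distrib)
  qed simp
qed

section \<open>Nonempty dimensions and vertex degrees\<close>

lemma simplices_nonempty:
  assumes V: "finite V" and X: "simplicial_complex V X" and j: "-1 \<le> j" "j \<le> complex_dim X"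
  shows "simplices X j \<noteq> {}"
proof -
  let ?K = "{i. simplices X i \<noteq> {}}"
  have XV: "X \<subseteq> Pow V" and down: "\<And>\<sigma> \<tau>. \<sigma> \<in> X \<Longrightarrow> \<tau> \<subseteq> \<sigma> \<Longrightarrow> \<tau> \<in> X"
    using X by (auto simp: simplicial_complex_def)
  \<comment> \<open>The empty family has dimension \<open>-2\<close>, below
    \<open>j\<close>.\<close>
  have "X \<noteq> {}" using j by (auto simp: complex_dim_def)
  then obtain \<sigma>0 where \<sigma>0: "\<sigma>0 \<in> X" by auto
  then have "finite \<sigma>0" using XV V by (auto intro: finite_subset)
  with \<sigma>0 have "\<sigma>0 \<in> simplices X (int (card \<sigma>0) - 1)" by (simp add: simplices_def)
  then have "?K \<noteq> {}" by auto
  moreover have "?K \<subseteq> {-1..int (card V)}"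
  proof
    fix i assume "i \<in> ?K"
    then obtain \<sigma> where "\<sigma> \<in> X" "int (card \<sigma>) = i + 1" by (auto simp: simplices_def)
    moreover from this have "card \<sigma> \<le> card V" using XV V by (auto intro: card_mono)
    ultimately show "i \<in> {-1..int (card V)}" by auto
  qed
  then have "finite ?K" by (rule finite_subset) simp
  ultimately have "Max ?K \<in> ?K" by (intro Max_in)
  then have "complex_dim X \<in> ?K" using \<open>X \<noteq> {}\<close> by (simp add: complex_dim_def)
  then obtain \<sigma> where \<sigma>: "\<sigma> \<in> X" "finite \<sigma>" "int (card \<sigma>) = complex_dim X + 1"
    by (auto simp: simplices_def)
  \<comment> \<open>Any \<open>j + 1\<close> vertices of a top-dimensional simplex span a
    \<open>j\<close>-simplex.\<close>
  have "nat (j + 1) \<le> card \<sigma>" using \<sigma>(3) j by linarith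
  then obtain \<tau> where "\<tau> \<subseteq> \<sigma>" "card \<tau> = nat (j + 1)" "finite \<tau>"
    by (rule obtain_subset_with_card_n)
  then have "\<tau> \<in> simplices X j" using down[OF \<sigma>(1)] j by (simp add: simplices_def)
  then show ?thesis by auto
qed

text \<open>Every simplex counted by the degree arises by adding one vertex to
  \<open>\<tau>\<close>, so these simplices are at most as many as the admissible vertices.\<close>

lemma min_degree_le:
  assumes V: "finite V" and X: "simplicial_complex V X" and \<tau>: "\<tau> \<in> simplices X k"
  shows "min_degree X k \<le> card {u \<in> V. u \<notin> \<tau> \<and> insert u \<tau> \<in> X}"
proof -
  have XV: "X \<subseteq> Pow V" using X by (simp add: simplicial_complex_def)
  then have "finite (simplices X k)"
    using V by (intro finite_subset[of "simplices X k" "Pow V"]) (auto simp: simplices_def)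
  then have "min_degree X k \<le> card {\<sigma> \<in> simplices X (k + 1). facet_of \<tau> \<sigma>}"
    unfolding min_degree_def using \<tau> by (intro Min_le) auto
  also have "\<dots> \<le> card ((\<lambda>u. insert u \<tau>) ` {u \<in> V. u \<notin> \<tau> \<and> insert u \<tau> \<in> X})"
  proof (rule card_mono)
    show "{\<sigma> \<in> simplices X (k + 1). facet_of \<tau> \<sigma>} \<subseteq> (\<lambda>u. insert u \<tau>) ` {u \<in> V. u \<notin> \<tau> \<and> insert u \<tau> \<in> X}"
    proof
      fix \<sigma> assume \<sigma>: "\<sigma> \<in> {\<sigma> \<in> simplices X (k + 1). facet_of \<tau> \<sigma>}"
      then obtain u where "\<tau> \<subseteq> \<sigma>" "\<sigma> - \<tau> = {u}" by (auto simp: facet_of_def card_1_singleton_iff)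
      then have u: "\<sigma> = insert u \<tau>" "u \<notin> \<tau>" by auto
      moreover have "\<sigma> \<in> X" "u \<in> V" using \<sigma> u XV by (auto simp: simplices_def)
      ultimately show "\<sigma> \<in> (\<lambda>u. insert u \<tau>) ` {u \<in> V. u \<notin> \<tau> \<and> insert u \<tau> \<in> X}" by auto
    qed
  qed (use V in simp)
  also have "\<dots> \<le> card {u \<in> V. u \<notin> \<tau> \<and> insert u \<tau> \<in> X}"
    using V by (intro card_image_le) simp
  finally show ?thesis .
qed

section \<open>Comparison of the least eigenvalues in degrees \<open>k\<close> and
  \<open>k + 1\<close>\<close>

theorem theorem6p1:
  fixes V :: "'v set" and X :: "'v set set" and k :: int and n :: nat
    and D :: "int \<Rightarrow> ('v set \<Rightarrow> 'a::{conjugatable_ordered_field, real_normed_field}) \<Rightarrow> 'v set \<Rightarrow> 'a"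
  assumes "finite V" and "n = card V"
    and "simplicial_complex V X"
    and "coboundary_operators (Pow V) D"
    and "0 \<le> k" and "k \<le> complex_dim X - 1"
    and "complex_dim X \<le> int n - 3"
  shows "real (min_degree X k) * mu_H X D k
           + (real n - real_of_int k - 2 - real (min_degree X k)) * real n
         \<ge> (real n - real_of_int k - 2) * mu_H X D (k + 1)"
proof -
  note V = assms(1) and n = assms(2) and X = assms(3) and D = assms(4) and k = assms(5)
  interpret incidence V "incidence_number D" using V D by (rule incidence_incidence_number)
  have XV: "X \<subseteq> Pow V" using X by (simp add: simplicial_complex_def)
  have sub: "simplices X j \<subseteq> Pow V" for j using XV by (auto simp: simplices_def)
  have fin: "finite (simplices X j)" for j
    by (rule finite_subset[OF sub]) (use V in simp)
  have ne: "simplices X k \<noteq> {}" "simplices X (k + 1) \<noteq> {}"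
    using simplices_nonempty[OF V X] k assms(6) by auto
  have lap: "hodge_laplacian X D j \<phi>
      = kernel_op (simplices X j) (simplices X j) (\<lambda>\<tau> \<sigma>. of_real (hodge_kernel X j \<tau> \<sigma>)) \<phi>"
    if "0 \<le> j" "\<phi> \<in> l2 (simplices X j)" for j and \<phi> :: "'v set \<Rightarrow> 'a"
    using V D XV that by (rule hodge_laplacian_eq_kernel_op)
  have eigenvector: "\<exists>\<phi>\<in>l2 (simplices X j). \<phi> \<noteq> (\<lambda>_. 0) \<and>
      kernel_op (simplices X j) (simplices X j) (hodge_kernel X j) \<phi> = (\<lambda>x. mu_H X D j * \<phi> x)"
    if "0 \<le> j" "simplices X j \<noteq> {}" for j
    unfolding mu_H_def using fin that(2) hodge_kernel_commute lap[OF that(1)]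
    by (rule min_spectrum_symmetric(1))
  \<comment> \<open>The Rayleigh bound in degree \<open>k + 1\<close>, rewritten by
    \<open>hodge_kernel_form\<close>; it supplies \<open>\<nu>' = n - \<mu>\<close> for the least
    eigenvalue \<open>\<mu>\<close> in that degree.\<close>
  have defect_bound: "(\<Sum>\<sigma>\<in>Pow V. (restrict0 (Pow V - X) (cobd \<chi>) \<sigma>)\<^sup>2)
      \<le> (real n - mu_H X D (k + 1)) * (\<Sum>\<sigma>\<in>Pow V. (\<chi> \<sigma>)\<^sup>2)" if \<chi>: "\<chi> \<in> l2 (simplices X (k + 1))" for \<chi>
  proof -
    have "mu_H X D (k + 1) * (\<Sum>\<sigma>\<in>simplices X (k + 1). (\<chi> \<sigma>)\<^sup>2) \<le> (\<Sum>\<sigma>\<in>simplices X (k + 1). \<chi> \<sigma> *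
        kernel_op (simplices X (k + 1)) (simplices X (k + 1)) (hodge_kernel X (k + 1)) \<chi> \<sigma>)"
      unfolding mu_H_def
      by (rule min_spectrum_symmetric(2)[OF fin ne(2) hodge_kernel_commute lap \<chi>]) (use k in simp_all)
    also have "(\<Sum>\<sigma>\<in>simplices X (k + 1). (\<chi> \<sigma>)\<^sup>2) = (\<Sum>\<sigma>\<in>Pow V. (\<chi> \<sigma>)\<^sup>2)"
      using V sub \<chi> by (intro sum.mono_neutral_left) (auto simp: l2_def)
    finally show ?thesis
      unfolding hodge_kernel_form[OF X \<chi>] n by (simp add: left_diff_distrib)
  qed
  \<comment> \<open>A nonzero function bounds a nonnegative sum by this number times a positive
    norm.\<close>
  have "0 \<le> real n - mu_H X D (k + 1)"
  proof -
    have "0 \<le> k + 1" using k by simp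
    from eigenvector[OF this ne(2)] obtain \<chi>
      where \<chi>: "\<chi> \<in> l2 (simplices X (k + 1))" "\<chi> \<noteq> (\<lambda>_. 0 :: real)"
      by blast
    have "\<chi> \<in> l2 (Pow V)" using \<chi>(1) sub by (auto simp: l2_def)
    then have pos: "0 < (\<Sum>\<sigma>\<in>Pow V. (\<chi> \<sigma>)\<^sup>2)" using V \<chi>(2) by (intro l2_sum_squares_pos) auto
    have "0 \<le> (\<Sum>\<sigma>\<in>Pow V. (restrict0 (Pow V - X) (cobd \<chi>) \<sigma>)\<^sup>2)" by (intro sum_nonneg) simp
    from order_trans[OF this defect_bound[OF \<chi>(1)]] pos show ?thesis by (simp add: zero_le_mult_iff)
  qed
  moreover obtain \<phi> where \<phi>: "\<phi> \<in> l2 (simplices X k)" "\<phi> \<noteq> (\<lambda>_. 0)"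
      "kernel_op (simplices X k) (simplices X k) (hodge_kernel X k) \<phi> = (\<lambda>x. mu_H X D k * \<phi> x)"
    using eigenvector[OF k ne(1)] by blast
  moreover have "bd (restrict0 (Pow V - X) (cobd \<phi>)) \<sigma> = (real n - mu_H X D k) * \<phi> \<sigma>"
    if "\<sigma> \<in> simplices X k" for \<sigma>
    using hodge_kernel_op_apply[OF X \<phi>(1) that] unfolding \<phi>(3) n by (simp add: left_diff_distrib)
  moreover have "real (min_degree X k) \<le> real (card {u \<in> V. u \<notin> \<tau> \<and> insert u \<tau> \<in> X})"
    if "\<tau> \<in> simplices X k" for \<tau>
    using min_degree_le[OF V X that] by simp
  \<comment> \<open>The two dimension hypotheses make the coefficient \<open>n - k - 2\<close>
    nonnegative.\<close>
  moreover have "k + 2 \<le> int (card V)" using assms(6,7) n by simp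
  ultimately have "real (min_degree X k) * (real n - mu_H X D k)
      \<le> (real (card V) - real_of_int k - 2) * (real n - mu_H X D (k + 1))"
    using defect_bound by (intro degree_times_defect_le[OF X \<phi>(1,2)]) auto
  then show ?thesis unfolding n by (simp add: algebra_simps)
qed

end
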